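(* Let $\mathbb{C}$ be a double category and $X\colon\mathbb{C}^{\mathrm{op}}\to\mathbb{C}\mathrm{at}$ a lax double presheaf. The canonical projection $\pi_X\colon\int\!\!\!\int_{\mathbb{C}}X\to\mathbb{C}$ is a discrete double fibration.
   Context: **Double categories.** A (strict) double category $\mathbb{C}$ has objects; horizontal morphisms $f\colon x\to y$ (composition $g\circ f$, identities $1_x$); vertical morphisms $u\colon x\nrightarrow x'$ (composition $u'\bullet u$, identities $e_x$); and squares $\alpha\colon[u\,{}^{f}_{f'}\,v]$ with left boundary $u\colon x\nrightarrow x'$, right boundary $v\colon y\nrightarrow y'$, top $f\colon x\to y$ and bottom $f'\colon x'\to y'$. Squares compose horizontally ($\beta\circ\alpha$, along a common vertical morphism, identities $1_u$) and vertically ($\alpha'\bullet\alpha$, along a common horizontal morphism, identities $e_f$). All compositions are strictly associative and unital, satisfy interchange, and $e_g\circ e_f=e_{g\circ f}$, $1_{u'}\bullet 1_u=1_{u'\bullet u}$, $e_{1_x}=1_{e_x}$. Double functors preserve all structure strictly. $\mathbb{C}^{\mathrm{op}}$ reverses horizontal morphisms and squares horizontally. **Profunctors.** A profunctor $U\colon \mathcal{A}\nrightarrow\mathcal{A}'$ is a functor $\mathcal{A}^{\mathrm{op}}\times\mathcal{A}'\to\mathrm{Set}$. Composition: $(U'\bullet U)(a,a'')=\int^{a'}U'(a',a'')\times U(a,a')$; the class of $(s',s)$ is $[s',s]$. The identity profunctor is the hom functor, and one chooses $U\bullet e_{\mathcal{A}}=U=e_{\mathcal{A}'}\bullet U$ via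 the co-Yoneda isomorphisms. $\mathbb{C}\mathrm{at}$ is the weak double category of small categories, functors (horizontal), profunctors (vertical), with squares $[U\,{}^{F}_{F'}\,V]$ the natural transformations $U\Rightarrow V(F^{\mathrm{op}}\times F')$. **Lax double presheaves.** A lax double presheaf over $\mathbb{C}$ is a normal lax double functor $X\colon\mathbb{C}^{\mathrm{op}}\to\mathbb{C}\mathrm{at}$. Explicitly: a category $Xx$ for each object $x$; a functor $Xf\colon Xy\to Xx$ for each horizontal $f\colon x\to y$; a profunctor $Xu\colon Xx^{\mathrm{op}}\times Xx'\to\mathrm{Set}$ for each vertical $u\colon x\nrightarrow x'$; a natural transformation $X\alpha\colon Xv\Rightarrow Xu(Xf^{\mathrm{op}}\times Xf')$ for each square $\alpha\colon[u\,{}^{f}_{f'}\,v]$; and a natural transformation $\mu_{u,u'}\colon Xu'\bullet Xu\Rightarrow X(u'\bullet u)$ for all composable vertical $u,u'$; such that (i) horizontal compositions and identities (of horizontal morphisms and of squares) are preserved strictly; (ii) $\mu$ is natural: $X(\alpha'\bullet\alpha)\circ\mu_{v,v'}=\mu_{u,u'}(Xf^{\mathrm{op}}\times Xf'')\circ(X\alpha'\bullet X\alpha)$ for vertically composable squares $\alpha\colon[u\,{}^{f}_{f'}\,v]$, $\alpha'\colon[u'\,{}^{f'}_{f''}\,v']$, and associative: $\mu_{u,u''\bullet u'}\circ(\mu_{u',u''}\bullet Xu)=\mu_{u'\bullet u,u''}\circ(Xu''\bullet\mu_{u,u'})$ up to the associator of profunctor composition; (iii) normality: $Xe_x$ is the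 hom functor of $Xx$, $Xe_f$ is the action of $Xf$ on homs, and $\mu_{e_x,u}$, $\mu_{u,e_{x'}}$ are identities at $Xu$. **Grothendieck construction.** $\int\!\!\!\int_{\mathbb{C}}X$ is the double category with objects $(x,x_-)$, $x\in\mathbb{C}$, $x_-\in Xx$; horizontal morphisms $(x,x_-)\to(y,y_-)$ the horizontal $f\colon x\to y$ with $x_-=Xf(y_-)$; vertical morphisms $(x,x_-)\nrightarrow(x',x'_-)$ the pairs $(u,u_-)$ with $u\colon x\nrightarrow x'$ and $u_-\in Xu(x_-,x'_-)$; squares $[(u,u_-)\,{}^{f}_{f'}\,(v,v_-)]$ from left objects $(x,x_-),(x',x'_-)$ to right objects $(y,y_-),(y',y'_-)$ the squares $\alpha\colon[u\,{}^{f}_{f'}\,v]$ with $u_-=(X\alpha)_{y_-,y'_-}(v_-)$. Compositions and identities of horizontal morphisms and squares are those of $\mathbb{C}$; $(u',u'_-)\bullet(u,u_-)=(u'\bullet u,(\mu_{u,u'})_{x_-,x''_-}([u'_-,u_-]))$; vertical identities are $(e_x,1_{x_-})$. The double functor $\pi_X$ projects onto the first component. **Discrete double fibrations.** A double functor $P\colon\mathbb{E}\to\mathbb{C}$ is a discrete double fibration if the commutative square of functors $t\colon\mathrm{Ver}_1\mathbb{E}\to\mathrm{Ver}_0\mathbb{E}$, $t\colon\mathrm{Ver}_1\mathbb{C}\to\mathrm{Ver}_0\mathbb{C}$, $\mathrm{Ver}_1P$, $\mathrm{Ver}_0P$ is a pullback in $\mathrm{Cat}$, where $\mathrm{Ver}_0$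 is the category of objects and vertical morphisms, $\mathrm{Ver}_1$ the category of horizontal morphisms and squares (composed vertically), and $t$ is the horizontal target. Equivalently: (1) for every object $y_-$ of $\mathbb{E}$ and horizontal $f\colon x\to Py_-$ there is a unique horizontal morphism of $\mathbb{E}$ with target $y_-$ over $f$; (2) for every vertical morphism $v_-$ of $\mathbb{E}$ and square $\alpha\colon[u\,{}^{f}_{f'}\,Pv_-]$ there is a unique square of $\mathbb{E}$ with right boundary $v_-$ over $\alpha$. *)

theory Defs
  imports Main
begin

section \<open>Categories and functors\<close>

text \<open>
  Partial operations are total functions whose values are constrained only on the carriers;
  accordingly functors and transformations are compared on carriers only.
  \<open>Cmp C g f\<close> is the composite "g after f".
\<close>

record ('o, 'a) cat =
  Obj :: "'o set"
  Arr :: "'a set"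
  Src :: "'a \<Rightarrow> 'o"
  Tgt :: "'a \<Rightarrow> 'o"
  Idn :: "'o \<Rightarrow> 'a"
  Cmp :: "'a \<Rightarrow> 'a \<Rightarrow> 'a"

locale category =
  fixes C :: "('o, 'a) cat"
  assumes Src_Obj: "f \<in> Arr C \<Longrightarrow> Src C f \<in> Obj C"
    and Tgt_Obj: "f \<in> Arr C \<Longrightarrow> Tgt C f \<in> Obj C"
    and Idn_Arr: "a \<in> Obj C \<Longrightarrow> Idn C a \<in> Arr C"
    and Src_Idn: "a \<in> Obj C \<Longrightarrow> Src C (Idn C a) = a"
    and Tgt_Idn: "a \<in> Obj C \<Longrightarrow> Tgt C (Idn C a) = a"
    and Cmp_Arr: "f \<in> Arr C \<Longrightarrow> g \<in> Arr C \<Longrightarrow> Src C g = Tgt C f \<Longrightarrow> Cmp C g f \<in> Arr C"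
    and Src_Cmp: "f \<in> Arr C \<Longrightarrow> g \<in> Arr C \<Longrightarrow> Src C g = Tgt C f \<Longrightarrow> Src C (Cmp C g f) = Src C f"
    and Tgt_Cmp: "f \<in> Arr C \<Longrightarrow> g \<in> Arr C \<Longrightarrow> Src C g = Tgt C f \<Longrightarrow> Tgt C (Cmp C g f) = Tgt C g"
    and Cmp_Idn_right: "f \<in> Arr C \<Longrightarrow> Cmp C f (Idn C (Src C f)) = f"
    and Cmp_Idn_left: "f \<in> Arr C \<Longrightarrow> Cmp C (Idn C (Tgt C f)) f = f"
    and Cmp_assoc: "f \<in> Arr C \<Longrightarrow> g \<in> Arr C \<Longrightarrow> h \<in> Arr C \<Longrightarrow>
      Src C g = Tgt C f \<Longrightarrow> Src C h = Tgt C g \<Longrightarrow>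
      Cmp C h (Cmp C g f) = Cmp C (Cmp C h g) f"

definition hom :: "('o, 'a) cat \<Rightarrow> 'o \<Rightarrow> 'o \<Rightarrow> 'a set" where
  "hom C a b = {f \<in> Arr C. Src C f = a \<and> Tgt C f = b}"

definition op_cat :: "('o, 'a) cat \<Rightarrow> ('o, 'a) cat" where
  "op_cat C = \<lparr>Obj = Obj C, Arr = Arr C, Src = Tgt C, Tgt = Src C, Idn = Idn C,
     Cmp = (\<lambda>g f. Cmp C f g)\<rparr>"

definition prod_cat :: "('o, 'a) cat \<Rightarrow> ('p, 'b) cat \<Rightarrow> ('o \<times> 'p, 'a \<times> 'b) cat" where
  "prod_cat A B = \<lparr>Obj = Obj A \<times> Obj B, Arr = Arr A \<times> Arr B,
     Src = map_prod (Src A) (Src B), Tgt = map_prod (Tgt A) (Tgt B),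
     Idn = map_prod (Idn A) (Idn B),
     Cmp = (\<lambda>(g, g') (f, f'). (Cmp A g f, Cmp B g' f'))\<rparr>"

record ('o, 'a, 'p, 'b) func =
  OMap :: "'o \<Rightarrow> 'p"
  AMap :: "'a \<Rightarrow> 'b"

locale cat_functor = A: category A + B: category B
  for A :: "('o, 'a) cat" and B :: "('p, 'b) cat" +
  fixes F :: "('o, 'a, 'p, 'b) func"
  assumes OMap_Obj: "a \<in> Obj A \<Longrightarrow> OMap F a \<in> Obj B"
    and AMap_Arr: "f \<in> Arr A \<Longrightarrow> AMap F f \<in> Arr B"
    and Src_AMap: "f \<in> Arr A \<Longrightarrow> Src B (AMap F f) = OMap F (Src A f)"
    and Tgt_AMap: "f \<in> Arr A \<Longrightarrow> Tgt B (AMap F f) = OMap F (Tgt A f)"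
    and AMap_Idn: "a \<in> Obj A \<Longrightarrow> AMap F (Idn A a) = Idn B (OMap F a)"
    and AMap_Cmp: "f \<in> Arr A \<Longrightarrow> g \<in> Arr A \<Longrightarrow> Src A g = Tgt A f \<Longrightarrow>
      AMap F (Cmp A g f) = Cmp B (AMap F g) (AMap F f)"

definition func_id :: "('o, 'a, 'o, 'a) func" where
  "func_id = \<lparr>OMap = (\<lambda>a. a), AMap = (\<lambda>f. f)\<rparr>"

definition func_comp ::
  "('p, 'b, 'r, 'c) func \<Rightarrow> ('o, 'a, 'p, 'b) func \<Rightarrow> ('o, 'a, 'r, 'c) func" where
  "func_comp G F = \<lparr>OMap = OMap G \<circ> OMap F, AMap = AMap G \<circ> AMap F\<rparr>"

text \<open>The functor \<open>F\<^sup>o\<^sup>p \<times> F'\<close>; the opposite of a functor has the same underlying maps.\<close>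

definition func_prod ::
  "('o, 'a, 'p, 'b) func \<Rightarrow> ('o', 'a', 'p', 'b') func \<Rightarrow>
   ('o \<times> 'o', 'a \<times> 'a', 'p \<times> 'p', 'b \<times> 'b') func" where
  "func_prod F F' = \<lparr>OMap = map_prod (OMap F) (OMap F'), AMap = map_prod (AMap F) (AMap F')\<rparr>"

definition func_eq ::
  "('o, 'a) cat \<Rightarrow> ('o, 'a, 'p, 'b) func \<Rightarrow> ('o, 'a, 'p, 'b) func \<Rightarrow> bool" where
  "func_eq A F G \<longleftrightarrow> (\<forall>a\<in>Obj A. OMap F a = OMap G a) \<and> (\<forall>f\<in>Arr A. AMap F f = AMap G f)"

text \<open>
  Pullback squares in the category of small categories,
  with \<open>p : P \<rightarrow> A\<close>, \<open>q : P \<rightarrow> B\<close>, \<open>r : A \<rightarrow> D\<close>, \<open>s : B \<rightarrow> D\<close>, given by the universal property.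
  A definition in HOL cannot quantify over types, so the types of the objects and arrows of the
  test categories \<open>Q\<close> appear as a phantom type argument. The actual universal property is the
  statement for all types, that is, with type variables in this place.
\<close>

definition is_pullback ::
  "('qo \<times> 'qa) itself \<Rightarrow>
   ('po, 'pa) cat \<Rightarrow> ('ao, 'aa) cat \<Rightarrow> ('bo, 'ba) cat \<Rightarrow> ('do, 'da) cat \<Rightarrow>
   ('po, 'pa, 'ao, 'aa) func \<Rightarrow> ('po, 'pa, 'bo, 'ba) func \<Rightarrow>
   ('ao, 'aa, 'do, 'da) func \<Rightarrow> ('bo, 'ba, 'do, 'da) func \<Rightarrow> bool" where
  "is_pullback _ P A B D p q r s \<longleftrightarrow>
     cat_functor P A p \<and> cat_functor P B q \<and> cat_functor A D r \<and> cat_functor B D s \<and>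
     func_eq P (func_comp r p) (func_comp s q) \<and>
     (\<forall>(Q :: ('qo, 'qa) cat) h k.
        cat_functor Q A h \<and> cat_functor Q B k \<and> func_eq Q (func_comp r h) (func_comp s k) \<longrightarrow>
        (\<exists>m. cat_functor Q P m \<and> func_eq Q (func_comp p m) h \<and> func_eq Q (func_comp q m) k \<and>
          (\<forall>m'. cat_functor Q P m' \<and> func_eq Q (func_comp p m') h \<and> func_eq Q (func_comp q m') k
             \<longrightarrow> func_eq Q m' m)))"

section \<open>Set-valued functors and profunctors\<close>

record ('o, 'a, 's) sfun =
  SOb :: "'o \<Rightarrow> 's set"
  SAr :: "'a \<Rightarrow> 's \<Rightarrow> 's"

locale set_functor = A: category A
  for A :: "('o, 'a) cat" +
  fixes U :: "('o, 'a, 's) sfun"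
  assumes SAr_mem: "f \<in> Arr A \<Longrightarrow> s \<in> SOb U (Src A f) \<Longrightarrow> SAr U f s \<in> SOb U (Tgt A f)"
    and SAr_Idn: "a \<in> Obj A \<Longrightarrow> s \<in> SOb U a \<Longrightarrow> SAr U (Idn A a) s = s"
    and SAr_Cmp: "f \<in> Arr A \<Longrightarrow> g \<in> Arr A \<Longrightarrow> Src A g = Tgt A f \<Longrightarrow> s \<in> SOb U (Src A f) \<Longrightarrow>
      SAr U (Cmp A g f) s = SAr U g (SAr U f s)"

definition sfun_pre :: "('p, 'b, 's) sfun \<Rightarrow> ('o, 'a, 'p, 'b) func \<Rightarrow> ('o, 'a, 's) sfun" where
  "sfun_pre U F = \<lparr>SOb = SOb U \<circ> OMap F, SAr = SAr U \<circ> AMap F\<rparr>"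

text \<open>Extensional equality of set-valued functors on \<open>A\<close>.\<close>

definition sfun_eq ::
  "('o, 'a) cat \<Rightarrow> ('o, 'a, 's) sfun \<Rightarrow> ('o, 'a, 's) sfun \<Rightarrow> bool" where
  "sfun_eq A U V \<longleftrightarrow> (\<forall>a\<in>Obj A. SOb U a = SOb V a) \<and>
     (\<forall>f\<in>Arr A. \<forall>s\<in>SOb U (Src A f). SAr U f s = SAr V f s)"

locale nat_trans = U: set_functor A U + V: set_functor A V
  for A :: "('o, 'a) cat" and U :: "('o, 'a, 's) sfun" and V :: "('o, 'a, 't) sfun" +
  fixes \<tau> :: "'o \<Rightarrow> 's \<Rightarrow> 't"
  assumes component: "a \<in> Obj A \<Longrightarrow> s \<in> SOb U a \<Longrightarrow> \<tau> a s \<in> SOb V a"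
    and naturality: "f \<in> Arr A \<Longrightarrow> s \<in> SOb U (Src A f) \<Longrightarrow>
      \<tau> (Tgt A f) (SAr U f s) = SAr V f (\<tau> (Src A f) s)"

definition profunctor ::
  "('o, 'a) cat \<Rightarrow> ('p, 'b) cat \<Rightarrow> ('o \<times> 'p, 'a \<times> 'b, 's) sfun \<Rightarrow> bool" where
  "profunctor A A' U \<longleftrightarrow> category A \<and> category A' \<and> set_functor (prod_cat (op_cat A) A') U"

definition prof_trans ::
  "('o, 'a) cat \<Rightarrow> ('p, 'b) cat \<Rightarrow> ('o \<times> 'p, 'a \<times> 'b, 's) sfun \<Rightarrow>
   ('o \<times> 'p, 'a \<times> 'b, 't) sfun \<Rightarrow> ('o \<times> 'p \<Rightarrow> 's \<Rightarrow> 't) \<Rightarrow> bool" where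
  "prof_trans A A' U V \<tau> \<longleftrightarrow> nat_trans (prod_cat (op_cat A) A') U V \<tau>"

definition hom_prof :: "('o, 'a) cat \<Rightarrow> ('o \<times> 'o, 'a \<times> 'a, 'a) sfun" where
  "hom_prof A = \<lparr>SOb = (\<lambda>(a, b). hom A a b), SAr = (\<lambda>(g, h) s. Cmp A h (Cmp A s g))\<rparr>"

text \<open>
  Composition of profunctors \<open>U\<close> from \<open>A\<close> to \<open>A'\<close> and \<open>U'\<close> from \<open>A'\<close> to \<open>A''\<close>:
  the coend at \<open>(a, a'')\<close> is the quotient of the set \<open>prof_pairs\<close> of triples \<open>(c, s', s)\<close> with
  \<open>s' \<in> U'(c, a'')\<close> and \<open>s \<in> U(a, c)\<close> by the equivalence relation generated by \<open>prof_step\<close>, and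
  \<open>prof_class \<dots> (c, s', s)\<close> is the class \<open>[s', s]\<close>.
\<close>

definition prof_pairs ::
  "('p, 'b) cat \<Rightarrow> ('p \<times> 'r, 'b \<times> 'c, 't) sfun \<Rightarrow> ('o \<times> 'p, 'a \<times> 'b, 's) sfun \<Rightarrow>
   'o \<Rightarrow> 'r \<Rightarrow> ('p \<times> 't \<times> 's) set" where
  "prof_pairs A' U' U a a'' =
     {(c, s', s). c \<in> Obj A' \<and> s' \<in> SOb U' (c, a'') \<and> s \<in> SOb U (a, c)}"

definition prof_step ::
  "('o, 'a) cat \<Rightarrow> ('p, 'b) cat \<Rightarrow> ('r, 'c) cat \<Rightarrow>
   ('p \<times> 'r, 'b \<times> 'c, 't) sfun \<Rightarrow> ('o \<times> 'p, 'a \<times> 'b, 's) sfun \<Rightarrow>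
   'o \<Rightarrow> 'r \<Rightarrow> (('p \<times> 't \<times> 's) \<times> ('p \<times> 't \<times> 's)) set" where
  "prof_step A A' A'' U' U a a'' =
     {((Src A' g, SAr U' (g, Idn A'' a'') s', s), (Tgt A' g, s', SAr U (Idn A a, g) s)) | g s' s.
        g \<in> Arr A' \<and> s' \<in> SOb U' (Tgt A' g, a'') \<and> s \<in> SOb U (a, Src A' g)}"

definition prof_equiv ::
  "('o, 'a) cat \<Rightarrow> ('p, 'b) cat \<Rightarrow> ('r, 'c) cat \<Rightarrow>
   ('p \<times> 'r, 'b \<times> 'c, 't) sfun \<Rightarrow> ('o \<times> 'p, 'a \<times> 'b, 's) sfun \<Rightarrow>
   'o \<Rightarrow> 'r \<Rightarrow> (('p \<times> 't \<times> 's) \<times> ('p \<times> 't \<times> 's)) set" where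
  "prof_equiv A A' A'' U' U a a'' =
     (prof_step A A' A'' U' U a a'' \<union> (prof_step A A' A'' U' U a a'')\<inverse>)\<^sup>*"

definition prof_class ::
  "('o, 'a) cat \<Rightarrow> ('p, 'b) cat \<Rightarrow> ('r, 'c) cat \<Rightarrow>
   ('p \<times> 'r, 'b \<times> 'c, 't) sfun \<Rightarrow> ('o \<times> 'p, 'a \<times> 'b, 's) sfun \<Rightarrow>
   'o \<Rightarrow> 'r \<Rightarrow> 'p \<times> 't \<times> 's \<Rightarrow> ('p \<times> 't \<times> 's) set" where
  "prof_class A A' A'' U' U a a'' z = prof_equiv A A' A'' U' U a a'' `` {z}"

text \<open>
  Maps out of a coend are written \<open>the_elem (f ` K)\<close>, where \<open>f\<close> is a function on representatives
  that is constant on every class \<open>K\<close>; this is the value of \<open>f\<close> at any representative.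
\<close>

definition prof_comp ::
  "('o, 'a) cat \<Rightarrow> ('p, 'b) cat \<Rightarrow> ('r, 'c) cat \<Rightarrow>
   ('p \<times> 'r, 'b \<times> 'c, 't) sfun \<Rightarrow> ('o \<times> 'p, 'a \<times> 'b, 's) sfun \<Rightarrow>
   ('o \<times> 'r, 'a \<times> 'c, ('p \<times> 't \<times> 's) set) sfun" where
  "prof_comp A A' A'' U' U =
     \<lparr>SOb = (\<lambda>(a, a''). prof_pairs A' U' U a a'' // prof_equiv A A' A'' U' U a a''),
      SAr = (\<lambda>(g, h) K. the_elem
        ((\<lambda>(c, s', s). prof_class A A' A'' U' U (Src A g) (Tgt A'' h)
            (c, SAr U' (Idn A' c, h) s', SAr U (g, Idn A' c) s)) ` K))\<rparr>"

text \<open>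
  Vertical composite \<open>[s', s] \<mapsto> [\<alpha>' s', \<alpha> s]\<close> of squares \<open>\<alpha> : U \<Rightarrow> V(F\<^sup>o\<^sup>p \<times> F')\<close> and
  \<open>\<alpha>' : U' \<Rightarrow> V'(F'\<^sup>o\<^sup>p \<times> F'')\<close>, where \<open>V\<close> goes from \<open>B\<close> to \<open>B'\<close> and \<open>V'\<close> from \<open>B'\<close> to \<open>B''\<close>.
\<close>

definition prof_sq_comp ::
  "('o, 'a) cat \<Rightarrow> ('p, 'b) cat \<Rightarrow> ('r, 'c) cat \<Rightarrow>
   ('p \<times> 'r, 'b \<times> 'c, 't) sfun \<Rightarrow> ('o \<times> 'p, 'a \<times> 'b, 's) sfun \<Rightarrow>
   ('o0, 'a0, 'o, 'a) func \<Rightarrow> ('p0, 'b0, 'p, 'b) func \<Rightarrow> ('r0, 'c0, 'r, 'c) func \<Rightarrow>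
   ('p0 \<times> 'r0 \<Rightarrow> 't0 \<Rightarrow> 't) \<Rightarrow> ('o0 \<times> 'p0 \<Rightarrow> 's0 \<Rightarrow> 's) \<Rightarrow>
   'o0 \<times> 'r0 \<Rightarrow> ('p0 \<times> 't0 \<times> 's0) set \<Rightarrow> ('p \<times> 't \<times> 's) set" where
  "prof_sq_comp B B' B'' V' V F F' F'' \<alpha>' \<alpha> = (\<lambda>(a, a'') K. the_elem
     ((\<lambda>(c, s', s). prof_class B B' B'' V' V (OMap F a) (OMap F'' a'')
         (OMap F' c, \<alpha>' (c, a'') s', \<alpha> (a, c) s)) ` K))"

text \<open>
  The associator \<open>(U'' \<bullet> U') \<bullet> U \<Rightarrow> U'' \<bullet> (U' \<bullet> U)\<close>, \<open>[[s'', s'], s] \<mapsto> [s'', [s', s]]\<close>.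
\<close>

definition prof_assoc ::
  "('o, 'a) cat \<Rightarrow> ('p, 'b) cat \<Rightarrow> ('r, 'c) cat \<Rightarrow> ('w, 'd) cat \<Rightarrow>
   ('r \<times> 'w, 'c \<times> 'd, 'q) sfun \<Rightarrow> ('p \<times> 'r, 'b \<times> 'c, 't) sfun \<Rightarrow> ('o \<times> 'p, 'a \<times> 'b, 's) sfun \<Rightarrow>
   'o \<times> 'w \<Rightarrow> ('p \<times> ('r \<times> 'q \<times> 't) set \<times> 's) set \<Rightarrow> ('r \<times> 'q \<times> ('p \<times> 't \<times> 's) set) set" where
  "prof_assoc A A' A'' A''' U'' U' U = (\<lambda>(a, a''') K. the_elem
     {prof_class A A'' A''' U'' (prof_comp A A' A'' U' U) a a'''
        (d, s'', prof_class A A' A'' U' U a d (c, s', s)) | c L s d s'' s'.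
        (c, L, s) \<in> K \<and> (d, s'', s') \<in> L})"

text \<open>
  The co-Yoneda isomorphisms \<open>U \<bullet> e \<cong> U\<close>, \<open>[s, g] \<mapsto> U(g, 1) s\<close>, and
  \<open>e \<bullet> U \<cong> U\<close>, \<open>[h, s] \<mapsto> U(1, h) s\<close>.
\<close>

definition coyoneda_right ::
  "('p, 'b) cat \<Rightarrow> ('o \<times> 'p, 'a \<times> 'b, 's) sfun \<Rightarrow> 'o \<times> 'p \<Rightarrow> ('o \<times> 's \<times> 'a) set \<Rightarrow> 's" where
  "coyoneda_right A' U = (\<lambda>(a, a') K. the_elem ((\<lambda>(c, s, g). SAr U (g, Idn A' a') s) ` K))"

definition coyoneda_left ::
  "('o, 'a) cat \<Rightarrow> ('o \<times> 'p, 'a \<times> 'b, 's) sfun \<Rightarrow> 'o \<times> 'p \<Rightarrow> ('p \<times> 'b \<times> 's) set \<Rightarrow> 's" where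
  "coyoneda_left A U = (\<lambda>(a, a') K. the_elem ((\<lambda>(c, h, s). SAr U (Idn A a, h) s) ` K))"

section \<open>Double categories\<close>

text \<open>
  A square has left and right boundary vertical morphisms and top and bottom boundary horizontal
  morphisms. \<open>sq_hid u\<close> and \<open>sq_hcmp\<close> are the horizontal identities \<open>1\<^sub>u\<close> and composition of squares,
  \<open>sq_vid f\<close> and \<open>sq_vcmp\<close> the vertical identities \<open>e\<^sub>f\<close> and composition.
  All compositions are in applicative order: \<open>vcmp C u' u\<close> is \<open>u' \<bullet> u\<close>.
\<close>

record ('o, 'h, 'v, 's) dcat =
  DObj :: "'o set"
  DHor :: "'h set"
  DVer :: "'v set"
  DSq :: "'s set"
  hsrc :: "'h \<Rightarrow> 'o"
  htgt :: "'h \<Rightarrow> 'o"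
  vsrc :: "'v \<Rightarrow> 'o"
  vtgt :: "'v \<Rightarrow> 'o"
  sq_left :: "'s \<Rightarrow> 'v"
  sq_right :: "'s \<Rightarrow> 'v"
  sq_top :: "'s \<Rightarrow> 'h"
  sq_bot :: "'s \<Rightarrow> 'h"
  hid :: "'o \<Rightarrow> 'h"
  hcmp :: "'h \<Rightarrow> 'h \<Rightarrow> 'h"
  vid :: "'o \<Rightarrow> 'v"
  vcmp :: "'v \<Rightarrow> 'v \<Rightarrow> 'v"
  sq_hid :: "'v \<Rightarrow> 's"
  sq_hcmp :: "'s \<Rightarrow> 's \<Rightarrow> 's"
  sq_vid :: "'h \<Rightarrow> 's"
  sq_vcmp :: "'s \<Rightarrow> 's \<Rightarrow> 's"

definition Hor0 :: "('o, 'h, 'v, 's) dcat \<Rightarrow> ('o, 'h) cat" where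
  "Hor0 C = \<lparr>Obj = DObj C, Arr = DHor C, Src = hsrc C, Tgt = htgt C, Idn = hid C, Cmp = hcmp C\<rparr>"

definition Hor1 :: "('o, 'h, 'v, 's) dcat \<Rightarrow> ('v, 's) cat" where
  "Hor1 C = \<lparr>Obj = DVer C, Arr = DSq C, Src = sq_left C, Tgt = sq_right C,
     Idn = sq_hid C, Cmp = sq_hcmp C\<rparr>"

definition Ver0 :: "('o, 'h, 'v, 's) dcat \<Rightarrow> ('o, 'v) cat" where
  "Ver0 C = \<lparr>Obj = DObj C, Arr = DVer C, Src = vsrc C, Tgt = vtgt C, Idn = vid C, Cmp = vcmp C\<rparr>"

definition Ver1 :: "('o, 'h, 'v, 's) dcat \<Rightarrow> ('h, 's) cat" where
  "Ver1 C = \<lparr>Obj = DHor C, Arr = DSq C, Src = sq_top C, Tgt = sq_bot C,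
     Idn = sq_vid C, Cmp = sq_vcmp C\<rparr>"

text \<open>
  The functors below (horizontal source and target, horizontal identities, and their vertical
  counterparts) encode the compatibility of boundaries at the corners of a square, the boundaries
  of identity and composite squares, and \<open>1\<^bsub>u' \<bullet> u\<^esub> = 1\<^bsub>u'\<^esub> \<bullet> 1\<^sub>u\<close>, \<open>e\<^bsub>g \<circ> f\<^esub> = e\<^sub>g \<circ> e\<^sub>f\<close> and
  \<open>e\<^bsub>1\<^sub>x\<^esub> = 1\<^bsub>e\<^sub>x\<^esub>\<close>.
\<close>

definition hsrc_func :: "('o, 'h, 'v, 's) dcat \<Rightarrow> ('h, 's, 'o, 'v) func" where
  "hsrc_func C = \<lparr>OMap = hsrc C, AMap = sq_left C\<rparr>"

definition htgt_func :: "('o, 'h, 'v, 's) dcat \<Rightarrow> ('h, 's, 'o, 'v) func" where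
  "htgt_func C = \<lparr>OMap = htgt C, AMap = sq_right C\<rparr>"

definition hid_func :: "('o, 'h, 'v, 's) dcat \<Rightarrow> ('o, 'v, 'h, 's) func" where
  "hid_func C = \<lparr>OMap = hid C, AMap = sq_hid C\<rparr>"

definition vsrc_func :: "('o, 'h, 'v, 's) dcat \<Rightarrow> ('v, 's, 'o, 'h) func" where
  "vsrc_func C = \<lparr>OMap = vsrc C, AMap = sq_top C\<rparr>"

definition vtgt_func :: "('o, 'h, 'v, 's) dcat \<Rightarrow> ('v, 's, 'o, 'h) func" where
  "vtgt_func C = \<lparr>OMap = vtgt C, AMap = sq_bot C\<rparr>"

definition vid_func :: "('o, 'h, 'v, 's) dcat \<Rightarrow> ('o, 'h, 'v, 's) func" where
  "vid_func C = \<lparr>OMap = vid C, AMap = sq_vid C\<rparr>"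

locale double_category =
  fixes C :: "('o, 'h, 'v, 's) dcat"
  assumes category_Hor0: "category (Hor0 C)"
    and category_Hor1: "category (Hor1 C)"
    and category_Ver0: "category (Ver0 C)"
    and category_Ver1: "category (Ver1 C)"
    and functor_hsrc: "cat_functor (Ver1 C) (Ver0 C) (hsrc_func C)"
    and functor_htgt: "cat_functor (Ver1 C) (Ver0 C) (htgt_func C)"
    and functor_hid: "cat_functor (Ver0 C) (Ver1 C) (hid_func C)"
    and functor_vsrc: "cat_functor (Hor1 C) (Hor0 C) (vsrc_func C)"
    and functor_vtgt: "cat_functor (Hor1 C) (Hor0 C) (vtgt_func C)"
    and functor_vid: "cat_functor (Hor0 C) (Hor1 C) (vid_func C)"
    and interchange:
      "\<alpha> \<in> DSq C \<Longrightarrow> \<beta> \<in> DSq C \<Longrightarrow> \<alpha>' \<in> DSq C \<Longrightarrow> \<beta>' \<in> DSq C \<Longrightarrow>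
       sq_left C \<beta> = sq_right C \<alpha> \<Longrightarrow> sq_left C \<beta>' = sq_right C \<alpha>' \<Longrightarrow>
       sq_top C \<alpha>' = sq_bot C \<alpha> \<Longrightarrow> sq_top C \<beta>' = sq_bot C \<beta> \<Longrightarrow>
       sq_vcmp C (sq_hcmp C \<beta>' \<alpha>') (sq_hcmp C \<beta> \<alpha>) =
       sq_hcmp C (sq_vcmp C \<beta>' \<beta>) (sq_vcmp C \<alpha>' \<alpha>)"

record ('o, 'h, 'v, 's, 'o1, 'h1, 'v1, 's1) dfunc =
  fobj :: "'o \<Rightarrow> 'o1"
  fhor :: "'h \<Rightarrow> 'h1"
  fver :: "'v \<Rightarrow> 'v1"
  fsq :: "'s \<Rightarrow> 's1"

definition Hor0_map ::
  "('o, 'h, 'v, 's, 'o1, 'h1, 'v1, 's1) dfunc \<Rightarrow> ('o, 'h, 'o1, 'h1) func" where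
  "Hor0_map P = \<lparr>OMap = fobj P, AMap = fhor P\<rparr>"

definition Hor1_map ::
  "('o, 'h, 'v, 's, 'o1, 'h1, 'v1, 's1) dfunc \<Rightarrow> ('v, 's, 'v1, 's1) func" where
  "Hor1_map P = \<lparr>OMap = fver P, AMap = fsq P\<rparr>"

definition Ver0_map ::
  "('o, 'h, 'v, 's, 'o1, 'h1, 'v1, 's1) dfunc \<Rightarrow> ('o, 'v, 'o1, 'v1) func" where
  "Ver0_map P = \<lparr>OMap = fobj P, AMap = fver P\<rparr>"

definition Ver1_map ::
  "('o, 'h, 'v, 's, 'o1, 'h1, 'v1, 's1) dfunc \<Rightarrow> ('h, 's, 'h1, 's1) func" where
  "Ver1_map P = \<lparr>OMap = fhor P, AMap = fsq P\<rparr>"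

locale double_functor = E: double_category E + C: double_category C
  for E :: "('o, 'h, 'v, 's) dcat" and C :: "('o1, 'h1, 'v1, 's1) dcat" +
  fixes P :: "('o, 'h, 'v, 's, 'o1, 'h1, 'v1, 's1) dfunc"
  assumes functor_Hor0: "cat_functor (Hor0 E) (Hor0 C) (Hor0_map P)"
    and functor_Hor1: "cat_functor (Hor1 E) (Hor1 C) (Hor1_map P)"
    and functor_Ver0: "cat_functor (Ver0 E) (Ver0 C) (Ver0_map P)"
    and functor_Ver1: "cat_functor (Ver1 E) (Ver1 C) (Ver1_map P)"

text \<open>The phantom type argument is that of \<^const>\<open>is_pullback\<close>.\<close>

definition discrete_double_fibration ::
  "('qo \<times> 'qa) itself \<Rightarrow> ('o, 'h, 'v, 's) dcat \<Rightarrow> ('o1, 'h1, 'v1, 's1) dcat \<Rightarrow>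
   ('o, 'h, 'v, 's, 'o1, 'h1, 'v1, 's1) dfunc \<Rightarrow> bool" where
  "discrete_double_fibration T E C P \<longleftrightarrow>
     double_functor E C P \<and>
     is_pullback T (Ver1 E) (Ver0 E) (Ver1 C) (Ver0 C)
       (htgt_func E) (Ver1_map P) (Ver0_map P) (htgt_func C)"

section \<open>Lax double presheaves\<close>

text \<open>
  All categories \<open>Xx\<close> are carved out of common types \<open>'p\<close> of objects and \<open>'q\<close> of arrows. Since
  \<open>Xe\<^sub>x\<close> has to be the hom functor of \<open>Xx\<close>, the elements of the profunctors \<open>Xu\<close> have type \<open>'q\<close> too.
  \<open>Xmu X u u'\<close> is the comparison \<open>\<mu>\<^bsub>u,u'\<^esub> : Xu' \<bullet> Xu \<Rightarrow> X(u' \<bullet> u)\<close>.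
\<close>

record ('o, 'h, 'v, 's, 'p, 'q) dpsh =
  Xcat :: "'o \<Rightarrow> ('p, 'q) cat"
  Xfun :: "'h \<Rightarrow> ('p, 'q, 'p, 'q) func"
  Xprof :: "'v \<Rightarrow> ('p \<times> 'p, 'q \<times> 'q, 'q) sfun"
  Xsq :: "'s \<Rightarrow> 'p \<times> 'p \<Rightarrow> 'q \<Rightarrow> 'q"
  Xmu :: "'v \<Rightarrow> 'v \<Rightarrow> 'p \<times> 'p \<Rightarrow> ('p \<times> 'q \<times> 'q) set \<Rightarrow> 'q"

definition Xcomp ::
  "('o, 'h, 'v, 's) dcat \<Rightarrow> ('o, 'h, 'v, 's, 'p, 'q) dpsh \<Rightarrow> 'v \<Rightarrow> 'v \<Rightarrow>
   ('p \<times> 'p, 'q \<times> 'q, ('p \<times> 'q \<times> 'q) set) sfun" where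
  "Xcomp C X u' u = prof_comp (Xcat X (vsrc C u)) (Xcat X (vtgt C u)) (Xcat X (vtgt C u'))
     (Xprof X u') (Xprof X u)"

definition Xclass ::
  "('o, 'h, 'v, 's) dcat \<Rightarrow> ('o, 'h, 'v, 's, 'p, 'q) dpsh \<Rightarrow> 'v \<Rightarrow> 'v \<Rightarrow>
   'p \<Rightarrow> 'p \<Rightarrow> 'p \<times> 'q \<times> 'q \<Rightarrow> ('p \<times> 'q \<times> 'q) set" where
  "Xclass C X u' u = prof_class (Xcat X (vsrc C u)) (Xcat X (vtgt C u)) (Xcat X (vtgt C u'))
     (Xprof X u') (Xprof X u)"

locale lax_double_presheaf = double_category C
  for C :: "('o, 'h, 'v, 's) dcat" +
  fixes X :: "('o, 'h, 'v, 's, 'p, 'q) dpsh"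
  assumes Xcat_category: "x \<in> DObj C \<Longrightarrow> category (Xcat X x)"
    and Xfun_functor: "f \<in> DHor C \<Longrightarrow>
      cat_functor (Xcat X (htgt C f)) (Xcat X (hsrc C f)) (Xfun X f)"
    and Xprof_profunctor: "u \<in> DVer C \<Longrightarrow>
      profunctor (Xcat X (vsrc C u)) (Xcat X (vtgt C u)) (Xprof X u)"
    and Xsq_trans: "\<alpha> \<in> DSq C \<Longrightarrow>
      prof_trans (Xcat X (vsrc C (sq_right C \<alpha>))) (Xcat X (vtgt C (sq_right C \<alpha>)))
        (Xprof X (sq_right C \<alpha>))
        (sfun_pre (Xprof X (sq_left C \<alpha>))
           (func_prod (Xfun X (sq_top C \<alpha>)) (Xfun X (sq_bot C \<alpha>))))
        (Xsq X \<alpha>)"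
    and Xmu_trans: "u \<in> DVer C \<Longrightarrow> u' \<in> DVer C \<Longrightarrow> vsrc C u' = vtgt C u \<Longrightarrow>
      prof_trans (Xcat X (vsrc C u)) (Xcat X (vtgt C u'))
        (Xcomp C X u' u) (Xprof X (vcmp C u' u)) (Xmu X u u')"
    and Xfun_hid: "x \<in> DObj C \<Longrightarrow> func_eq (Xcat X x) (Xfun X (hid C x)) func_id"
    and Xfun_hcmp: "f \<in> DHor C \<Longrightarrow> g \<in> DHor C \<Longrightarrow> hsrc C g = htgt C f \<Longrightarrow>
      func_eq (Xcat X (htgt C g)) (Xfun X (hcmp C g f)) (func_comp (Xfun X f) (Xfun X g))"
    and Xsq_hid: "u \<in> DVer C \<Longrightarrow> a \<in> Obj (Xcat X (vsrc C u)) \<Longrightarrow> a' \<in> Obj (Xcat X (vtgt C u)) \<Longrightarrow>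
      s \<in> SOb (Xprof X u) (a, a') \<Longrightarrow> Xsq X (sq_hid C u) (a, a') s = s"
    and Xsq_hcmp: "\<alpha> \<in> DSq C \<Longrightarrow> \<beta> \<in> DSq C \<Longrightarrow> sq_left C \<beta> = sq_right C \<alpha> \<Longrightarrow>
      a \<in> Obj (Xcat X (vsrc C (sq_right C \<beta>))) \<Longrightarrow> a' \<in> Obj (Xcat X (vtgt C (sq_right C \<beta>))) \<Longrightarrow>
      s \<in> SOb (Xprof X (sq_right C \<beta>)) (a, a') \<Longrightarrow>
      Xsq X (sq_hcmp C \<beta> \<alpha>) (a, a') s =
      Xsq X \<alpha> (OMap (Xfun X (sq_top C \<beta>)) a, OMap (Xfun X (sq_bot C \<beta>)) a')
        (Xsq X \<beta> (a, a') s)"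
    and Xmu_natural: "\<alpha> \<in> DSq C \<Longrightarrow> \<alpha>' \<in> DSq C \<Longrightarrow> sq_top C \<alpha>' = sq_bot C \<alpha> \<Longrightarrow>
      u = sq_left C \<alpha> \<Longrightarrow> u' = sq_left C \<alpha>' \<Longrightarrow> v = sq_right C \<alpha> \<Longrightarrow> v' = sq_right C \<alpha>' \<Longrightarrow>
      a \<in> Obj (Xcat X (vsrc C v)) \<Longrightarrow> a'' \<in> Obj (Xcat X (vtgt C v')) \<Longrightarrow>
      K \<in> SOb (Xcomp C X v' v) (a, a'') \<Longrightarrow>
      Xsq X (sq_vcmp C \<alpha>' \<alpha>) (a, a'') (Xmu X v v' (a, a'') K) =
      Xmu X u u' (OMap (Xfun X (sq_top C \<alpha>)) a, OMap (Xfun X (sq_bot C \<alpha>')) a'')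
        (prof_sq_comp (Xcat X (vsrc C u)) (Xcat X (vtgt C u)) (Xcat X (vtgt C u'))
           (Xprof X u') (Xprof X u)
           (Xfun X (sq_top C \<alpha>)) (Xfun X (sq_bot C \<alpha>)) (Xfun X (sq_bot C \<alpha>'))
           (Xsq X \<alpha>') (Xsq X \<alpha>) (a, a'') K)"
    and Xmu_assoc: "u \<in> DVer C \<Longrightarrow> u' \<in> DVer C \<Longrightarrow> u'' \<in> DVer C \<Longrightarrow>
      vsrc C u' = vtgt C u \<Longrightarrow> vsrc C u'' = vtgt C u' \<Longrightarrow>
      A = Xcat X (vsrc C u) \<Longrightarrow> A' = Xcat X (vtgt C u) \<Longrightarrow>
      A'' = Xcat X (vtgt C u') \<Longrightarrow> A''' = Xcat X (vtgt C u'') \<Longrightarrow>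
      a \<in> Obj A \<Longrightarrow> a''' \<in> Obj A''' \<Longrightarrow>
      M \<in> SOb (prof_comp A A' A''' (Xcomp C X u'' u') (Xprof X u)) (a, a''') \<Longrightarrow>
      Xmu X u (vcmp C u'' u') (a, a''')
        (prof_sq_comp A A' A''' (Xprof X (vcmp C u'' u')) (Xprof X u) func_id func_id func_id
           (Xmu X u' u'') (\<lambda>_ s. s) (a, a''') M) =
      Xmu X (vcmp C u' u) u'' (a, a''')
        (prof_sq_comp A A'' A''' (Xprof X u'') (Xprof X (vcmp C u' u)) func_id func_id func_id
           (\<lambda>_ s. s) (Xmu X u u') (a, a''')
           (prof_assoc A A' A'' A''' (Xprof X u'') (Xprof X u') (Xprof X u) (a, a''') M))"
    and Xprof_vid: "x \<in> DObj C \<Longrightarrow>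
      sfun_eq (prod_cat (op_cat (Xcat X x)) (Xcat X x)) (Xprof X (vid C x)) (hom_prof (Xcat X x))"
    and Xsq_vid: "f \<in> DHor C \<Longrightarrow> a \<in> Obj (Xcat X (htgt C f)) \<Longrightarrow> a' \<in> Obj (Xcat X (htgt C f)) \<Longrightarrow>
      s \<in> hom (Xcat X (htgt C f)) a a' \<Longrightarrow> Xsq X (sq_vid C f) (a, a') s = AMap (Xfun X f) s"
    \<comment> \<open>\<open>\<mu>\<close> is the identity once \<open>U \<bullet> e\<close> and \<open>e \<bullet> U\<close> are identified with \<open>U\<close>\<close>
    and Xmu_vid_right: "u \<in> DVer C \<Longrightarrow>
      a \<in> Obj (Xcat X (vsrc C u)) \<Longrightarrow> a' \<in> Obj (Xcat X (vtgt C u)) \<Longrightarrow>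
      K \<in> SOb (Xcomp C X u (vid C (vsrc C u))) (a, a') \<Longrightarrow>
      Xmu X (vid C (vsrc C u)) u (a, a') K =
      coyoneda_right (Xcat X (vtgt C u)) (Xprof X u) (a, a') K"
    and Xmu_vid_left: "u \<in> DVer C \<Longrightarrow>
      a \<in> Obj (Xcat X (vsrc C u)) \<Longrightarrow> a' \<in> Obj (Xcat X (vtgt C u)) \<Longrightarrow>
      K \<in> SOb (Xcomp C X (vid C (vtgt C u)) u) (a, a') \<Longrightarrow>
      Xmu X u (vid C (vtgt C u)) (a, a') K =
      coyoneda_left (Xcat X (vsrc C u)) (Xprof X u) (a, a') K"

section \<open>The Grothendieck construction\<close>

text \<open>
  Morphisms carry their boundary: a horizontal morphism \<open>f : (x, x\<^sub>-) \<rightarrow> (y, y\<^sub>-)\<close> is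
  \<open>(x\<^sub>-, f, y\<^sub>-)\<close>, a vertical morphism \<open>(u, u\<^sub>-)\<close> from \<open>(x, x\<^sub>-)\<close> to \<open>(x', x'\<^sub>-)\<close> is
  \<open>(x\<^sub>-, (u, u\<^sub>-), x'\<^sub>-)\<close>, and a square \<open>\<alpha>\<close> is \<open>(l, \<alpha>, r)\<close> with \<open>l\<close> and \<open>r\<close> its left and right boundary.
\<close>

type_synonym ('h, 'p) ghor = "'p \<times> 'h \<times> 'p"
type_synonym ('v, 'p, 'q) gver = "'p \<times> ('v \<times> 'q) \<times> 'p"
type_synonym ('v, 's, 'p, 'q) gsq = "('v, 'p, 'q) gver \<times> 's \<times> ('v, 'p, 'q) gver"

definition groth_obj ::
  "('o, 'h, 'v, 's) dcat \<Rightarrow> ('o, 'h, 'v, 's, 'p, 'q) dpsh \<Rightarrow> ('o \<times> 'p) set" where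
  "groth_obj C X = {(x, a). x \<in> DObj C \<and> a \<in> Obj (Xcat X x)}"

definition groth_hor ::
  "('o, 'h, 'v, 's) dcat \<Rightarrow> ('o, 'h, 'v, 's, 'p, 'q) dpsh \<Rightarrow> ('h, 'p) ghor set" where
  "groth_hor C X = {(a, f, b). f \<in> DHor C \<and> a \<in> Obj (Xcat X (hsrc C f)) \<and>
     b \<in> Obj (Xcat X (htgt C f)) \<and> a = OMap (Xfun X f) b}"

definition groth_ver ::
  "('o, 'h, 'v, 's) dcat \<Rightarrow> ('o, 'h, 'v, 's, 'p, 'q) dpsh \<Rightarrow> ('v, 'p, 'q) gver set" where
  "groth_ver C X = {(a, (u, s), a'). u \<in> DVer C \<and> a \<in> Obj (Xcat X (vsrc C u)) \<and>
     a' \<in> Obj (Xcat X (vtgt C u)) \<and> s \<in> SOb (Xprof X u) (a, a')}"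

definition groth_sq ::
  "('o, 'h, 'v, 's) dcat \<Rightarrow> ('o, 'h, 'v, 's, 'p, 'q) dpsh \<Rightarrow> ('v, 's, 'p, 'q) gsq set" where
  "groth_sq C X = {((a, (u, s), a'), \<alpha>, (b, (v, t), b')). \<alpha> \<in> DSq C \<and>
     (a, (u, s), a') \<in> groth_ver C X \<and> u = sq_left C \<alpha> \<and>
     (b, (v, t), b') \<in> groth_ver C X \<and> v = sq_right C \<alpha> \<and>
     (a, sq_top C \<alpha>, b) \<in> groth_hor C X \<and> (a', sq_bot C \<alpha>, b') \<in> groth_hor C X \<and>
     s = Xsq X \<alpha> (b, b') t}"

definition groth_vcmp ::
  "('o, 'h, 'v, 's) dcat \<Rightarrow> ('o, 'h, 'v, 's, 'p, 'q) dpsh \<Rightarrow>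
   ('v, 'p, 'q) gver \<Rightarrow> ('v, 'p, 'q) gver \<Rightarrow> ('v, 'p, 'q) gver" where
  "groth_vcmp C X = (\<lambda>(a', (u', s'), a'') (a, (u, s), c).
     (a, (vcmp C u' u, Xmu X u u' (a, a'') (Xclass C X u' u a a'' (c, s', s))), a''))"

definition groth_vid ::
  "('o, 'h, 'v, 's) dcat \<Rightarrow> ('o, 'h, 'v, 's, 'p, 'q) dpsh \<Rightarrow> 'o \<times> 'p \<Rightarrow> ('v, 'p, 'q) gver" where
  "groth_vid C X = (\<lambda>(x, a). (a, (vid C x, Idn (Xcat X x) a), a))"

definition groth ::
  "('o, 'h, 'v, 's) dcat \<Rightarrow> ('o, 'h, 'v, 's, 'p, 'q) dpsh \<Rightarrow>
   ('o \<times> 'p, ('h, 'p) ghor, ('v, 'p, 'q) gver, ('v, 's, 'p, 'q) gsq) dcat" where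
  "groth C X = \<lparr>
     DObj = groth_obj C X,
     DHor = groth_hor C X,
     DVer = groth_ver C X,
     DSq = groth_sq C X,
     hsrc = (\<lambda>(a, f, b). (hsrc C f, a)),
     htgt = (\<lambda>(a, f, b). (htgt C f, b)),
     vsrc = (\<lambda>(a, (u, s), a'). (vsrc C u, a)),
     vtgt = (\<lambda>(a, (u, s), a'). (vtgt C u, a')),
     sq_left = (\<lambda>(l, \<alpha>, r). l),
     sq_right = (\<lambda>(l, \<alpha>, r). r),
     sq_top = (\<lambda>((a, _, a'), \<alpha>, (b, _, b')). (a, sq_top C \<alpha>, b)),
     sq_bot = (\<lambda>((a, _, a'), \<alpha>, (b, _, b')). (a', sq_bot C \<alpha>, b')),
     hid = (\<lambda>(x, a). (a, hid C x, a)),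
     hcmp = (\<lambda>(b, g, c) (a, f, b'). (a, hcmp C g f, c)),
     vid = groth_vid C X,
     vcmp = groth_vcmp C X,
     sq_hid = (\<lambda>(a, (u, s), a'). ((a, (u, s), a'), sq_hid C u, (a, (u, s), a'))),
     sq_hcmp = (\<lambda>(m, \<beta>, r) (l, \<alpha>, m'). (l, sq_hcmp C \<beta> \<alpha>, r)),
     sq_vid = (\<lambda>(a, f, b).
       (groth_vid C X (hsrc C f, a), sq_vid C f, groth_vid C X (htgt C f, b))),
     sq_vcmp = (\<lambda>(l', \<alpha>', r') (l, \<alpha>, r).
       (groth_vcmp C X l' l, sq_vcmp C \<alpha>' \<alpha>, groth_vcmp C X r' r))\<rparr>"

definition groth_proj ::
  "('o \<times> 'p, ('h, 'p) ghor, ('v, 'p, 'q) gver, ('v, 's, 'p, 'q) gsq, 'o, 'h, 'v, 's) dfunc" where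
  "groth_proj = \<lparr>
     fobj = (\<lambda>(x, a). x),
     fhor = (\<lambda>(a, f, b). f),
     fver = (\<lambda>(a, (u, s), a'). u),
     fsq = (\<lambda>(l, \<alpha>, r). \<alpha>)\<rparr>"

end

theory Submission
  imports Defs
begin

text \<open>
  In \<open>\<integral>\<integral>\<^sub>C X\<close> the data over a square \<open>\<alpha>\<close> of \<open>C\<close> flow from right to left: once the right boundary
  \<open>(b, (v, t), b')\<close> is given, the remaining corners have to be the values of \<open>Xf\<close> at \<open>b\<close> and of \<open>Xf'\<close>
  at \<open>b'\<close>, where \<open>f\<close> and \<open>f'\<close> are the top and bottom of \<open>\<alpha>\<close>, and the element on the left has to be
  \<open>X\<alpha>(t)\<close>. Conversely these values do bound a square. In the same way a horizontal morphism over
  \<open>f\<close> is determined by its target, which may be any object over the target of \<open>f\<close>. This gives unique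
  lifts (\<open>groth_hor_unique_lift\<close>, \<open>groth_sq_unique_lift\<close>). A commutative square of functors is a
  pullback as soon as the objects and the arrows of its corner are the pullbacks of sets
  (\<open>is_pullbackI\<close>), so unique lifts are all that the fibration condition asks for.

  The main work is to see that \<open>\<integral>\<integral>\<^sub>C X\<close> is a double category at all (\<open>double_category_groth\<close>).
  Horizontally this is functoriality of \<open>f \<mapsto> Xf\<close> and \<open>\<alpha> \<mapsto> X\<alpha>\<close>. Vertically, the composite of
  \<open>(u', s')\<close> and \<open>(u, s)\<close> carries the element \<open>\<mu>[s', s]\<close>, and the associativity, the unit laws and the
  naturality of \<open>\<mu>\<close> have to be read off on such elements (\<open>mult_assoc\<close>, \<open>mult_vid_right\<close>,
  \<open>mult_vid_left\<close>, \<open>Xsq_mult\<close>). The axioms for \<open>\<mu>\<close> speak of maps between coends, so each of these maps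
  is first evaluated on a class \<open>[s', s]\<close>. Every such evaluation amounts to the independence of the
  representative, which has to be checked only for the generating steps of the equivalence relation.
\<close>

section \<open>Pullbacks of categories\<close>

text \<open>
  The pullback of categories is computed on objects and on arrows. Since an object or arrow of \<open>P\<close> is
  known from its images under \<open>p\<close> and \<open>q\<close>, the pointwise choice of a map into \<open>P\<close> is automatically
  functorial, and it is unique for the same reason.
\<close>

lemma is_pullbackI:
  fixes P :: "('po, 'pa) cat"
  assumes p: "cat_functor P A p" and q: "cat_functor P B q"
    and r: "cat_functor A D r" and s: "cat_functor B D s"
    and comm: "func_eq P (func_comp r p) (func_comp s q)"
    and obj: "\<And>a b. a \<in> Obj A \<Longrightarrow> b \<in> Obj B \<Longrightarrow> OMap r a = OMap s b \<Longrightarrow>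
      \<exists>!x. x \<in> Obj P \<and> OMap p x = a \<and> OMap q x = b"
    and arr: "\<And>a b. a \<in> Arr A \<Longrightarrow> b \<in> Arr B \<Longrightarrow> AMap r a = AMap s b \<Longrightarrow>
      \<exists>!x. x \<in> Arr P \<and> AMap p x = a \<and> AMap q x = b"
  shows "is_pullback TYPE('qo \<times> 'qa) P A B D p q r s"
proof -
  interpret p: cat_functor P A p by (rule p)
  interpret q: cat_functor P B q by (rule q)
  have ext_obj: "x = y" if "x \<in> Obj P" "y \<in> Obj P" "OMap p x = OMap p y" "OMap q x = OMap q y" for x y
    using obj[of "OMap p x" "OMap q x"] that p.OMap_Obj q.OMap_Obj comm
    by (auto simp: func_eq_def func_comp_def)
  have ext_arr: "x = y" if "x \<in> Arr P" "y \<in> Arr P" "AMap p x = AMap p y" "AMap q x = AMap q y" for x y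
    using arr[of "AMap p x" "AMap q x"] that p.AMap_Arr q.AMap_Arr comm
    by (auto simp: func_eq_def func_comp_def)
  have "\<exists>m. cat_functor Q P m \<and> func_eq Q (func_comp p m) h \<and> func_eq Q (func_comp q m) k \<and>
      (\<forall>m'. cat_functor Q P m' \<and> func_eq Q (func_comp p m') h \<and> func_eq Q (func_comp q m') k
         \<longrightarrow> func_eq Q m' m)"
    if h: "cat_functor Q A h" and k: "cat_functor Q B k"
      and hk: "func_eq Q (func_comp r h) (func_comp s k)"
    for Q :: "('qo, 'qa) cat" and h k
  proof -
    interpret h: cat_functor Q A h by (rule h)
    interpret k: cat_functor Q B k by (rule k)
    have "\<forall>a\<in>Obj Q. \<exists>x. x \<in> Obj P \<and> OMap p x = OMap h a \<and> OMap q x = OMap k a"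
      using obj h.OMap_Obj k.OMap_Obj hk by (simp add: func_eq_def func_comp_def) blast
    then obtain mo where mo: "mo a \<in> Obj P" "OMap p (mo a) = OMap h a" "OMap q (mo a) = OMap k a"
      if "a \<in> Obj Q" for a
      by metis
    have "\<forall>f\<in>Arr Q. \<exists>x. x \<in> Arr P \<and> AMap p x = AMap h f \<and> AMap q x = AMap k f"
      using arr h.AMap_Arr k.AMap_Arr hk by (simp add: func_eq_def func_comp_def) blast
    then obtain ma where ma: "ma f \<in> Arr P" "AMap p (ma f) = AMap h f" "AMap q (ma f) = AMap k f"
      if "f \<in> Arr Q" for f
      by metis
    define m where "m = \<lparr>OMap = mo, AMap = ma\<rparr>"
    have src: "Src P (ma f) = mo (Src Q f)" if "f \<in> Arr Q" for f
      using that by (intro ext_obj) (simp_all add: mo ma p.A.Src_Obj h.A.Src_Obj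
          p.Src_AMap[symmetric] q.Src_AMap[symmetric] h.Src_AMap k.Src_AMap)
    have tgt: "Tgt P (ma f) = mo (Tgt Q f)" if "f \<in> Arr Q" for f
      using that by (intro ext_obj) (simp_all add: mo ma p.A.Tgt_Obj h.A.Tgt_Obj
          p.Tgt_AMap[symmetric] q.Tgt_AMap[symmetric] h.Tgt_AMap k.Tgt_AMap)
    have m: "cat_functor Q P m"
    proof
      show "AMap m (Idn Q a) = Idn P (OMap m a)" if "a \<in> Obj Q" for a
        using that by (intro ext_arr) (simp_all add: m_def mo ma p.A.Idn_Arr h.A.Idn_Arr
            p.AMap_Idn q.AMap_Idn h.AMap_Idn k.AMap_Idn)
      show "AMap m (Cmp Q g f) = Cmp P (AMap m g) (AMap m f)"
        if "f \<in> Arr Q" "g \<in> Arr Q" "Src Q g = Tgt Q f" for f g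
        using that by (intro ext_arr) (simp_all add: m_def ma src tgt p.A.Cmp_Arr h.A.Cmp_Arr
            p.AMap_Cmp q.AMap_Cmp h.AMap_Cmp k.AMap_Cmp)
    qed (simp_all add: m_def mo ma src tgt)
    have unique: "func_eq Q m' m"
      if m': "cat_functor Q P m'"
        and eqs: "func_eq Q (func_comp p m') h" "func_eq Q (func_comp q m') k" for m'
      using eqs cat_functor.OMap_Obj[OF m'] cat_functor.AMap_Arr[OF m']
      by (auto simp: func_eq_def func_comp_def m_def mo ma intro!: ext_obj ext_arr)
    have "func_eq Q (func_comp p m) h" "func_eq Q (func_comp q m) k"
      by (simp_all add: func_eq_def func_comp_def m_def mo ma)
    with m unique show ?thesis
      by (intro exI[of _ m] conjI allI impI) simp_all
  qed
  with p q r s comm show ?thesis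
    unfolding is_pullback_def by (intro conjI allI impI) simp_all
qed

section \<open>Coends of profunctors\<close>

lemma profunctor_mem:
  assumes "profunctor A B U" "g \<in> Arr A" "h \<in> Arr B" "s \<in> SOb U (Tgt A g, Src B h)"
  shows "SAr U (g, h) s \<in> SOb U (Src A g, Tgt B h)"
  using assms set_functor.SAr_mem[of "prod_cat (op_cat A) B" U "(g, h)" s]
  by (simp add: profunctor_def prod_cat_def op_cat_def)

lemma profunctor_Idn:
  assumes "profunctor A B U" "a \<in> Obj A" "b \<in> Obj B" "s \<in> SOb U (a, b)"
  shows "SAr U (Idn A a, Idn B b) s = s"
  using assms set_functor.SAr_Idn[of "prod_cat (op_cat A) B" U "(a, b)" s]
  by (simp add: profunctor_def prod_cat_def op_cat_def)

lemma profunctor_Cmp: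
  assumes "profunctor A B U" "g \<in> Arr A" "g' \<in> Arr A" "Src A g = Tgt A g'"
    "h \<in> Arr B" "h' \<in> Arr B" "Src B h' = Tgt B h" "s \<in> SOb U (Tgt A g, Src B h)"
  shows "SAr U (g', h') (SAr U (g, h) s) = SAr U (Cmp A g g', Cmp B h' h) s"
  using assms set_functor.SAr_Cmp[of "prod_cat (op_cat A) B" U "(g, h)" "(g', h')" s]
  by (simp add: profunctor_def prod_cat_def op_cat_def)

text \<open>
  Both sides are the action of the pair \<open>(g, h)\<close>.
\<close>

lemma profunctor_actions_commute:
  assumes U: "profunctor A B U" and g: "g \<in> Arr A" and h: "h \<in> Arr B"
    and s: "s \<in> SOb U (Tgt A g, Src B h)"
  shows "SAr U (Idn A (Src A g), h) (SAr U (g, Idn B (Src B h)) s) =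
    SAr U (g, Idn B (Tgt B h)) (SAr U (Idn A (Tgt A g), h) s)"
proof -
  interpret A: category A using U by (simp add: profunctor_def)
  interpret B: category B using U by (simp add: profunctor_def)
  show ?thesis
    using g h s
    by (simp add: profunctor_Cmp[OF U] A.Src_Obj A.Tgt_Obj A.Idn_Arr A.Src_Idn A.Tgt_Idn
        B.Src_Obj B.Tgt_Obj B.Idn_Arr B.Src_Idn B.Tgt_Idn
        A.Cmp_Idn_left A.Cmp_Idn_right B.Cmp_Idn_left B.Cmp_Idn_right)
qed

lemma the_elem_unique:
  assumes "t \<in> S" and "\<And>x. x \<in> S \<Longrightarrow> x = t"
  shows "the_elem S = t"
proof -
  have "S = {t}" using assms by blast
  then show ?thesis by simp
qed

text \<open>
  The equivalence relation is generated by the steps, so a function that is invariant under steps is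
  constant on classes. This is the universal property of the coend, and all maps out of coends
  below are evaluated by it.
\<close>

lemma prof_class_invariant:
  assumes y: "y \<in> prof_class A A' A'' U' U a a'' z"
    and step: "\<And>g s' s. g \<in> Arr A' \<Longrightarrow> s' \<in> SOb U' (Tgt A' g, a'') \<Longrightarrow> s \<in> SOb U (a, Src A' g) \<Longrightarrow>
      f (Src A' g, SAr U' (g, Idn A'' a'') s', s) = f (Tgt A' g, s', SAr U (Idn A a, g) s)"
  shows "f y = f z"
proof -
  have "(z, y) \<in> prof_equiv A A' A'' U' U a a''"
    using y by (simp add: prof_class_def)
  then show ?thesis
    unfolding prof_equiv_def
  proof (induction rule: rtrancl_induct)
    case (step x y)
    then show ?case
      using assms(2) by (auto simp: prof_step_def)
  qed simp
qed

lemma prof_class_self: "z \<in> prof_class A A' A'' U' U a a'' z"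
  by (simp add: prof_class_def prof_equiv_def)

lemma image_prof_class:
  assumes "\<And>g s' s. g \<in> Arr A' \<Longrightarrow> s' \<in> SOb U' (Tgt A' g, a'') \<Longrightarrow> s \<in> SOb U (a, Src A' g) \<Longrightarrow>
      f (Src A' g, SAr U' (g, Idn A'' a'') s', s) = f (Tgt A' g, s', SAr U (Idn A a, g) s)"
  shows "f ` prof_class A A' A'' U' U a a'' z = {f z}"
proof (intro equalityI subsetI)
  fix t assume "t \<in> f ` prof_class A A' A'' U' U a a'' z"
  then obtain y where y: "y \<in> prof_class A A' A'' U' U a a'' z" "t = f y" by blast
  have "f y = f z" by (rule prof_class_invariant[where f = f, OF y(1) assms])
  then show "t \<in> {f z}" using y by simp
next
  have "f z \<in> f ` prof_class A A' A'' U' U a a'' z"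
    by (rule imageI) (rule prof_class_self)
  then show "t \<in> f ` prof_class A A' A'' U' U a a'' z" if "t \<in> {f z}" for t
    using that by simp
qed

lemma the_elem_image_prof_class:
  assumes "\<And>g s' s. g \<in> Arr A' \<Longrightarrow> s' \<in> SOb U' (Tgt A' g, a'') \<Longrightarrow> s \<in> SOb U (a, Src A' g) \<Longrightarrow>
      f (Src A' g, SAr U' (g, Idn A'' a'') s', s) = f (Tgt A' g, s', SAr U (Idn A a, g) s)"
  shows "the_elem (f ` prof_class A A' A'' U' U a a'' z) = f z"
  using image_prof_class[where f = f, OF assms] by simp

lemma prof_class_step:
  assumes "g \<in> Arr A'" "s' \<in> SOb U' (Tgt A' g, a'')" "s \<in> SOb U (a, Src A' g)"
  shows "prof_class A A' A'' U' U a a'' (Src A' g, SAr U' (g, Idn A'' a'') s', s) =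
    prof_class A A' A'' U' U a a'' (Tgt A' g, s', SAr U (Idn A a, g) s)"
proof -
  let ?y = "(Src A' g, SAr U' (g, Idn A'' a'') s', s)" and ?z = "(Tgt A' g, s', SAr U (Idn A a, g) s)"
  let ?R = "prof_step A A' A'' U' U a a'' \<union> (prof_step A A' A'' U' U a a'')\<inverse>"
  have "(?y, ?z) \<in> ?R" "(?z, ?y) \<in> ?R"
    using assms by (auto simp: prof_step_def)
  then have "(?y, w) \<in> ?R\<^sup>* \<longleftrightarrow> (?z, w) \<in> ?R\<^sup>*" for w
    by (meson converse_rtrancl_into_rtrancl)
  then show ?thesis
    unfolding prof_class_def prof_equiv_def by (intro set_eqI) (simp only: Image_singleton_iff)
qed

lemma prof_class_mem:
  assumes "c \<in> Obj A'" "s' \<in> SOb U' (c, a'')" "s \<in> SOb U (a, c)"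
  shows "prof_class A A' A'' U' U a a'' (c, s', s) \<in> SOb (prof_comp A A' A'' U' U) (a, a'')"
  using assms by (auto simp: prof_comp_def prof_class_def prof_pairs_def intro!: quotientI)

lemma prof_comp_cases:
  assumes "L \<in> SOb (prof_comp A A' A'' U' U) (a, a'')"
  obtains c s' s where "c \<in> Obj A'" "s' \<in> SOb U' (c, a'')" "s \<in> SOb U (a, c)"
    "L = prof_class A A' A'' U' U a a'' (c, s', s)"
  using assms by (auto simp: prof_comp_def prof_class_def prof_pairs_def elim!: quotientE)

text \<open>
  The two outer actions pass to classes because they commute with the inner actions, which
  generate the equivalence.
\<close>

lemma SAr_prof_comp:
  assumes U: "profunctor A A' U" and U': "profunctor A' A'' U'"
    and g: "g \<in> Arr A" and h: "h \<in> Arr A''"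
  shows "SAr (prof_comp A A' A'' U' U) (g, h)
      (prof_class A A' A'' U' U (Tgt A g) (Src A'' h) (c, s', s)) =
    prof_class A A' A'' U' U (Src A g) (Tgt A'' h)
      (c, SAr U' (Idn A' c, h) s', SAr U (g, Idn A' c) s)"
proof -
  interpret A: category A using U by (simp add: profunctor_def)
  interpret A': category A' using U by (simp add: profunctor_def)
  interpret A'': category A'' using U' by (simp add: profunctor_def)
  let ?f = "\<lambda>(c, s', s). prof_class A A' A'' U' U (Src A g) (Tgt A'' h)
    (c, SAr U' (Idn A' c, h) s', SAr U (g, Idn A' c) s)"
  have "?f (Src A' k, SAr U' (k, Idn A'' (Src A'' h)) s', s) =
      ?f (Tgt A' k, s', SAr U (Idn A (Tgt A g), k) s)"
    if k: "k \<in> Arr A'" and s': "s' \<in> SOb U' (Tgt A' k, Src A'' h)"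
      and s: "s \<in> SOb U (Tgt A g, Src A' k)" for k s' s
    using k s s' g h profunctor_actions_commute[OF U' k h s']
      profunctor_actions_commute[OF U g k s]
      prof_class_step[of k A' "SAr U' (Idn A' (Tgt A' k), h) s'" U' "Tgt A'' h"
        "SAr U (g, Idn A' (Src A' k)) s" U "Src A g" A A'']
      profunctor_mem[OF U', of "Idn A' (Tgt A' k)" h s']
      profunctor_mem[OF U, of g "Idn A' (Src A' k)" s]
    by (simp add: A'.Idn_Arr A'.Src_Obj A'.Tgt_Obj A'.Src_Idn A'.Tgt_Idn)
  then show ?thesis
    using the_elem_image_prof_class[where f = ?f and A = A and A' = A' and A'' = A''
        and U = U and U' = U' and a = "Tgt A g" and a'' = "Src A'' h" and z = "(c, s', s)"]
    by (simp add: prof_comp_def)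
qed

text \<open>
  Naturality of \<open>\<alpha>\<close> and \<open>\<alpha>'\<close> turns a step along \<open>g\<close> into a step along \<open>F' g\<close>. With identity functors and
  one identity transformation this also evaluates the whiskerings in the associativity law of \<open>\<mu>\<close>.
\<close>

lemma prof_sq_comp_class:
  assumes F: "cat_functor A B F" and F': "cat_functor A' B' F'" and F'': "cat_functor A'' B'' F''"
    and \<alpha>: "prof_trans A A' U (sfun_pre V (func_prod F F')) \<alpha>"
    and \<alpha>': "prof_trans A' A'' U' (sfun_pre V' (func_prod F' F'')) \<alpha>'"
    and a: "a \<in> Obj A" and a'': "a'' \<in> Obj A''"
  shows "prof_sq_comp B B' B'' V' V F F' F'' \<alpha>' \<alpha> (a, a'')
      (prof_class A A' A'' U' U a a'' (c, s', s)) =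
    prof_class B B' B'' V' V (OMap F a) (OMap F'' a'')
      (OMap F' c, \<alpha>' (c, a'') s', \<alpha> (a, c) s)"
proof -
  interpret F: cat_functor A B F by (rule F)
  interpret F': cat_functor A' B' F' by (rule F')
  interpret F'': cat_functor A'' B'' F'' by (rule F'')
  interpret \<alpha>: nat_trans "prod_cat (op_cat A) A'" U "sfun_pre V (func_prod F F')" \<alpha>
    using \<alpha> by (simp add: prof_trans_def)
  interpret \<alpha>': nat_trans "prod_cat (op_cat A') A''" U' "sfun_pre V' (func_prod F' F'')" \<alpha>'
    using \<alpha>' by (simp add: prof_trans_def)
  let ?f = "\<lambda>(c, s', s). prof_class B B' B'' V' V (OMap F a) (OMap F'' a'')
      (OMap F' c, \<alpha>' (c, a'') s', \<alpha> (a, c) s)"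
  have "?f (Src A' g, SAr U' (g, Idn A'' a'') s', s) = ?f (Tgt A' g, s', SAr U (Idn A a, g) s)"
    if g: "g \<in> Arr A'" and s': "s' \<in> SOb U' (Tgt A' g, a'')" and s: "s \<in> SOb U (a, Src A' g)"
    for g s' s
  proof -
    have "\<alpha>' (Src A' g, a'') (SAr U' (g, Idn A'' a'') s') =
        SAr V' (AMap F' g, Idn B'' (OMap F'' a'')) (\<alpha>' (Tgt A' g, a'') s')"
      using \<alpha>'.naturality[of "(g, Idn A'' a'')" s'] g s' a''
      by (simp add: prod_cat_def op_cat_def sfun_pre_def func_prod_def F''.AMap_Idn
          F''.A.Idn_Arr F''.A.Src_Idn F''.A.Tgt_Idn)
    moreover have "\<alpha> (a, Tgt A' g) (SAr U (Idn A a, g) s) =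
        SAr V (Idn B (OMap F a), AMap F' g) (\<alpha> (a, Src A' g) s)"
      using \<alpha>.naturality[of "(Idn A a, g)" s] g s a
      by (simp add: prod_cat_def op_cat_def sfun_pre_def func_prod_def F.AMap_Idn
          F.A.Idn_Arr F.A.Src_Idn F.A.Tgt_Idn)
    moreover have "\<alpha>' (Tgt A' g, a'') s' \<in> SOb V' (OMap F' (Tgt A' g), OMap F'' a'')"
      using \<alpha>'.component[of "(Tgt A' g, a'')" s'] g s' a''
      by (simp add: prod_cat_def op_cat_def sfun_pre_def func_prod_def F'.A.Tgt_Obj)
    moreover have "\<alpha> (a, Src A' g) s \<in> SOb V (OMap F a, OMap F' (Src A' g))"
      using \<alpha>.component[of "(a, Src A' g)" s] g s a
      by (simp add: prod_cat_def op_cat_def sfun_pre_def func_prod_def F'.A.Src_Obj)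
    ultimately show ?thesis
      using prof_class_step[of "AMap F' g" B' "\<alpha>' (Tgt A' g, a'') s'" V' "OMap F'' a''"
          "\<alpha> (a, Src A' g) s" V "OMap F a" B B''] g
      by (simp add: F'.Src_AMap F'.Tgt_AMap F'.AMap_Arr)
  qed
  then show ?thesis
    using the_elem_image_prof_class[where f = ?f and A = A and A' = A' and A'' = A''
        and U = U and U' = U' and a = a and a'' = a'' and z = "(c, s', s)"]
    by (simp add: prof_sq_comp_def)
qed

text \<open>
  The associator chooses representatives twice: of the outer class and, inside it, of the class
  \<open>[s'', s']\<close>. Both choices are harmless. A step along \<open>k\<close> in the inner class is moved by the action on
  \<open>U' \<bullet> U\<close> to a step of the target, and a step along \<open>g\<close> in the outer class becomes a step inside the
  class \<open>[s', s]\<close> of the target.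
\<close>

lemma prof_assoc_class:
  assumes U: "profunctor A A' U" and U': "profunctor A' A'' U'" and U'': "profunctor A'' A''' U''"
    and a: "a \<in> Obj A" and a''': "a''' \<in> Obj A'''"
    and c: "c \<in> Obj A'" and s: "s \<in> SOb U (a, c)"
  shows "prof_assoc A A' A'' A''' U'' U' U (a, a''')
      (prof_class A A' A''' (prof_comp A' A'' A''' U'' U') U a a'''
        (c, prof_class A' A'' A''' U'' U' c a''' (d, s'', s'), s)) =
    prof_class A A'' A''' U'' (prof_comp A A' A'' U' U) a a'''
      (d, s'', prof_class A A' A'' U' U a d (c, s', s))"
proof -
  interpret A: category A using U by (simp add: profunctor_def)
  interpret A': category A' using U by (simp add: profunctor_def)
  interpret A'': category A'' using U' by (simp add: profunctor_def)
  interpret A''': category A''' using U'' by (simp add: profunctor_def)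
  let ?t = "\<lambda>c s (d, s'', s'). prof_class A A'' A''' U'' (prof_comp A A' A'' U' U) a a'''
      (d, s'', prof_class A A' A'' U' U a d (c, s', s))"
  let ?G = "\<lambda>(c, L, s). ?t c s ` L"
  \<comment> \<open>independence of the representative of \<open>[s'', s']\<close>\<close>
  have inner: "?t c s ` prof_class A' A'' A''' U'' U' c a''' z = {?t c s z}"
    if c: "c \<in> Obj A'" and s: "s \<in> SOb U (a, c)" for c s z
  proof (rule image_prof_class)
    fix k q' q
    assume k: "k \<in> Arr A''" and q': "q' \<in> SOb U'' (Tgt A'' k, a''')"
      and q: "q \<in> SOb U' (c, Src A'' k)"
    have "SAr (prof_comp A A' A'' U' U) (Idn A a, k) (prof_class A A' A'' U' U a (Src A'' k) (c, q, s)) =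
        prof_class A A' A'' U' U a (Tgt A'' k) (c, SAr U' (Idn A' c, k) q, s)"
      using SAr_prof_comp[OF U U' A.Idn_Arr[OF a] k, of c q s] profunctor_Idn[OF U a c s]
      by (simp add: A.Src_Idn A.Tgt_Idn a)
    then show "?t c s (Src A'' k, SAr U'' (k, Idn A''' a''') q', q) =
        ?t c s (Tgt A'' k, q', SAr U' (Idn A' c, k) q)"
      using prof_class_step[OF k q', where U = "prof_comp A A' A'' U' U",
          OF prof_class_mem[OF c q s], of A A''']
      by simp
  qed
  \<comment> \<open>independence of the representative of the outer class, for the set of all values at once\<close>
  have outer: "?G y = ?G (c, prof_class A' A'' A''' U'' U' c a''' (d, s'', s'), s)"
    if "y \<in> prof_class A A' A''' (prof_comp A' A'' A''' U'' U') U a a'''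
        (c, prof_class A' A'' A''' U'' U' c a''' (d, s'', s'), s)" for y
    using that
  proof (rule prof_class_invariant)
    fix g L s
    assume g: "g \<in> Arr A'" and L: "L \<in> SOb (prof_comp A' A'' A''' U'' U') (Tgt A' g, a''')"
      and s: "s \<in> SOb U (a, Src A' g)"
    from L obtain d q' q where d: "d \<in> Obj A''" and q': "q' \<in> SOb U'' (d, a''')"
      and q: "q \<in> SOb U' (Tgt A' g, d)"
      and L_eq: "L = prof_class A' A'' A''' U'' U' (Tgt A' g) a''' (d, q', q)"
      by (rule prof_comp_cases)
    have act: "SAr (prof_comp A' A'' A''' U'' U') (g, Idn A''' a''') L =
        prof_class A' A'' A''' U'' U' (Src A' g) a''' (d, q', SAr U' (g, Idn A'' d) q)"
      using SAr_prof_comp[OF U' U'' g A'''.Idn_Arr[OF a'''], of d q' q]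
        profunctor_Idn[OF U'' d a''' q']
      by (simp add: L_eq A'''.Src_Idn A'''.Tgt_Idn a''')
    have s2: "SAr U (Idn A a, g) s \<in> SOb U (a, Tgt A' g)"
      using profunctor_mem[OF U, of "Idn A a" g s] a g s by (simp add: A.Idn_Arr A.Src_Idn A.Tgt_Idn)
    show "?G (Src A' g, SAr (prof_comp A' A'' A''' U'' U') (g, Idn A''' a''') L, s) =
        ?G (Tgt A' g, L, SAr U (Idn A a, g) s)"
      unfolding prod.case act
      by (simp only: L_eq inner[OF A'.Src_Obj[OF g] s] inner[OF A'.Tgt_Obj[OF g] s2]
          prof_class_step[OF g q s] prod.case)
  qed
  let ?M = "prof_class A A' A''' (prof_comp A' A'' A''' U'' U') U a a'''
        (c, prof_class A' A'' A''' U'' U' c a''' (d, s'', s'), s)"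
  let ?S = "{?t c s (d, s'', s') | c L s d s'' s'. (c, L, s) \<in> ?M \<and> (d, s'', s') \<in> L}"
  have "t = ?t c s (d, s'', s')" if "t \<in> ?S" for t
  proof -
    from that obtain c1 L1 s1 z1 where y: "(c1, L1, s1) \<in> ?M" and z1: "z1 \<in> L1" "t = ?t c1 s1 z1"
      by (elim CollectE exE conjE) (rule that)
    have "t \<in> ?t c1 s1 ` L1"
      unfolding z1(2) using z1(1) by (rule imageI)
    then show ?thesis
      using outer[OF y] inner[OF c s, of "(d, s'', s')"] by (simp only: prod.case singleton_iff)
  qed
  moreover have "?t c s (d, s'', s') \<in> ?S"
    by (intro CollectI exI conjI) (rule refl prof_class_self)+
  ultimately have "the_elem ?S = ?t c s (d, s'', s')"
    by (rule the_elem_unique[rotated])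
  then show ?thesis
    by (simp only: prof_assoc_def prod.case)
qed

text \<open>
  The next three facts present a transformation between profunctors as a square between identity
  functors, the form in which \<open>prof_sq_comp_class\<close> takes it.
\<close>

lemma sfun_pre_id: "sfun_pre U (func_prod func_id func_id) = U"
  by (simp add: sfun_pre_def func_prod_def func_id_def comp_def map_prod_def)

lemma cat_functor_id: "category A \<Longrightarrow> cat_functor A A func_id"
  by (simp add: cat_functor_def cat_functor_axioms_def func_id_def)

lemma prof_trans_id: "profunctor A B U \<Longrightarrow> prof_trans A B U U (\<lambda>_ s. s)"
  by (simp add: prof_trans_def profunctor_def nat_trans_def nat_trans_axioms_def)

text \<open>
  Only the restriction of \<open>E\<close> to the carriers is known to be the hom functor, hence \<open>sfun_eq\<close>.
  The value does not depend on the representative because \<open>U\<close> preserves composition.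
\<close>

lemma coyoneda_right_class:
  assumes U: "profunctor A A' U" and E: "sfun_eq (prod_cat (op_cat A) A) E (hom_prof A)"
    and a: "a \<in> Obj A" and a': "a' \<in> Obj A'"
  shows "coyoneda_right A' U (a, a') (prof_class A A A' U E a a' (c, s, g)) =
    SAr U (g, Idn A' a') s"
proof -
  interpret A: category A using U by (simp add: profunctor_def)
  interpret A': category A' using U by (simp add: profunctor_def)
  let ?f = "\<lambda>(c, s, g). SAr U (g, Idn A' a') s"
  have "?f (Src A k, SAr U (k, Idn A' a') s, g) = ?f (Tgt A k, s, SAr E (Idn A a, k) g)"
    if k: "k \<in> Arr A" and s: "s \<in> SOb U (Tgt A k, a')" and g: "g \<in> SOb E (a, Src A k)" for k s g
  proof -
    have E_ob: "SOb E (x, y) = hom A x y" if "x \<in> Obj A" "y \<in> Obj A" for x y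
      using E that by (simp add: sfun_eq_def prod_cat_def op_cat_def hom_prof_def)
    have g': "g \<in> Arr A" "Src A g = a" "Tgt A g = Src A k"
      using g E_ob[of a "Src A k"] k a by (simp_all add: A.Src_Obj hom_def)
    have "SAr E (Idn A a, k) g = SAr (hom_prof A) (Idn A a, k) g"
      using E k g a by (simp add: sfun_eq_def prod_cat_def op_cat_def A.Idn_Arr A.Src_Idn A.Tgt_Idn)
    then have "SAr E (Idn A a, k) g = Cmp A k g"
      using g' A.Cmp_Idn_right[of g] by (simp add: hom_prof_def)
    then show ?thesis
      using k s g' a' A'.Cmp_Idn_left[of "Idn A' a'"]
      by (simp add: profunctor_Cmp[OF U] A'.Idn_Arr A'.Src_Idn A'.Tgt_Idn)
  qed
  then show ?thesis
    using the_elem_image_prof_class[where f = ?f and A = A and A' = A and A'' = A'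
        and U = E and U' = U and a = a and a'' = a' and z = "(c, s, g)"]
    by (simp add: coyoneda_right_def)
qed

lemma coyoneda_left_class:
  assumes U: "profunctor A A' U" and E: "sfun_eq (prod_cat (op_cat A') A') E (hom_prof A')"
    and a: "a \<in> Obj A" and a': "a' \<in> Obj A'"
  shows "coyoneda_left A U (a, a') (prof_class A A' A' E U a a' (c, h, s)) =
    SAr U (Idn A a, h) s"
proof -
  interpret A: category A using U by (simp add: profunctor_def)
  interpret A': category A' using U by (simp add: profunctor_def)
  let ?f = "\<lambda>(c, h, s). SAr U (Idn A a, h) s"
  have "?f (Src A' k, SAr E (k, Idn A' a') h, s) = ?f (Tgt A' k, h, SAr U (Idn A a, k) s)"
    if k: "k \<in> Arr A'" and h: "h \<in> SOb E (Tgt A' k, a')" and s: "s \<in> SOb U (a, Src A' k)" for k h s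
  proof -
    have E_ob: "SOb E (x, y) = hom A' x y" if "x \<in> Obj A'" "y \<in> Obj A'" for x y
      using E that by (simp add: sfun_eq_def prod_cat_def op_cat_def hom_prof_def)
    have h': "h \<in> Arr A'" "Src A' h = Tgt A' k" "Tgt A' h = a'"
      using h E_ob[of "Tgt A' k" a'] k a' by (simp_all add: A'.Tgt_Obj hom_def)
    have "SAr E (k, Idn A' a') h = SAr (hom_prof A') (k, Idn A' a') h"
      using E k h a' by (simp add: sfun_eq_def prod_cat_def op_cat_def A'.Idn_Arr A'.Src_Idn A'.Tgt_Idn)
    then have "SAr E (k, Idn A' a') h = Cmp A' h k"
      using h' k A'.Cmp_Idn_left[of "Cmp A' h k"]
      by (simp add: hom_prof_def A'.Cmp_Arr A'.Tgt_Cmp)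
    then show ?thesis
      using k s h' a A.Cmp_Idn_left[of "Idn A a"]
      by (simp add: profunctor_Cmp[OF U] A.Idn_Arr A.Src_Idn A.Tgt_Idn)
  qed
  then show ?thesis
    using the_elem_image_prof_class[where f = ?f and A = A and A' = A' and A'' = A'
        and U = U and U' = E and a = a and a'' = a' and z = "(c, h, s)"]
    by (simp add: coyoneda_left_def)
qed

section \<open>Double categories\<close>

lemmas (in category) category_laws = Src_Obj Tgt_Obj Idn_Arr Src_Idn Tgt_Idn
  Cmp_Arr Src_Cmp Tgt_Cmp Cmp_Idn_right Cmp_Idn_left Cmp_assoc

text \<open>
  Each corner of a square lies on a vertical and on a horizontal boundary. For rewriting, the corners
  are always expressed through the horizontal boundaries \<open>sq_top\<close> and \<open>sq_bot\<close>; together with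
  the opposite equations, which come from the functors \<open>vsrc_func\<close> and \<open>vtgt_func\<close>, the rules would loop.
\<close>

context double_category
begin

lemmas Hor0_laws = category.category_laws[OF category_Hor0, unfolded Hor0_def cat.simps]
lemmas Hor1_laws = category.category_laws[OF category_Hor1, unfolded Hor1_def cat.simps]
lemmas Ver0_laws = category.category_laws[OF category_Ver0, unfolded Ver0_def cat.simps]
lemmas Ver1_laws = category.category_laws[OF category_Ver1, unfolded Ver1_def cat.simps]

lemmas vsrc_sq_left = cat_functor.Src_AMap[OF functor_hsrc, unfolded Ver0_def Ver1_def hsrc_func_def cat.simps func.simps]
lemmas vtgt_sq_left = cat_functor.Tgt_AMap[OF functor_hsrc, unfolded Ver0_def Ver1_def hsrc_func_def cat.simps func.simps]
lemmas vsrc_sq_right = cat_functor.Src_AMap[OF functor_htgt, unfolded Ver0_def Ver1_def htgt_func_def cat.simps func.simps]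
lemmas vtgt_sq_right = cat_functor.Tgt_AMap[OF functor_htgt, unfolded Ver0_def Ver1_def htgt_func_def cat.simps func.simps]

lemmas sq_left_vid = cat_functor.AMap_Idn[OF functor_hsrc, unfolded Ver0_def Ver1_def hsrc_func_def cat.simps func.simps]
lemmas sq_left_vcmp = cat_functor.AMap_Cmp[OF functor_hsrc, unfolded Ver0_def Ver1_def hsrc_func_def cat.simps func.simps]
lemmas sq_right_vid = cat_functor.AMap_Idn[OF functor_htgt, unfolded Ver0_def Ver1_def htgt_func_def cat.simps func.simps]
lemmas sq_right_vcmp = cat_functor.AMap_Cmp[OF functor_htgt, unfolded Ver0_def Ver1_def htgt_func_def cat.simps func.simps]
lemmas sq_top_hid = cat_functor.AMap_Idn[OF functor_vsrc, unfolded Hor0_def Hor1_def vsrc_func_def cat.simps func.simps]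
lemmas sq_top_hcmp = cat_functor.AMap_Cmp[OF functor_vsrc, unfolded Hor0_def Hor1_def vsrc_func_def cat.simps func.simps]
lemmas sq_bot_hid = cat_functor.AMap_Idn[OF functor_vtgt, unfolded Hor0_def Hor1_def vtgt_func_def cat.simps func.simps]
lemmas sq_bot_hcmp = cat_functor.AMap_Cmp[OF functor_vtgt, unfolded Hor0_def Hor1_def vtgt_func_def cat.simps func.simps]
lemmas sq_hid_vid = cat_functor.AMap_Idn[OF functor_hid, unfolded Ver0_def Ver1_def hid_func_def cat.simps func.simps]
lemmas sq_hid_vcmp = cat_functor.AMap_Cmp[OF functor_hid, unfolded Ver0_def Ver1_def hid_func_def cat.simps func.simps]
lemmas sq_vid_hcmp = cat_functor.AMap_Cmp[OF functor_vid, unfolded Hor0_def Hor1_def vid_func_def cat.simps func.simps]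

lemmas double_laws = Hor0_laws Hor1_laws Ver0_laws Ver1_laws
  vsrc_sq_left vtgt_sq_left vsrc_sq_right vtgt_sq_right
  sq_left_vid sq_left_vcmp sq_right_vid sq_right_vcmp
  sq_top_hid sq_top_hcmp sq_bot_hid sq_bot_hcmp sq_hid_vid sq_hid_vcmp sq_vid_hcmp

end

section \<open>Lax double presheaves on elements\<close>

context lax_double_presheaf
begin

text \<open>
  The element \<open>\<mu>\<^bsub>u,u'\<^esub>[s', s]\<close> of \<open>X(u' \<bullet> u)(a, a'')\<close>, for \<open>s \<in> Xu(a, c)\<close> and \<open>s' \<in> Xu'(c, a'')\<close>. The
  associativity and unit laws of \<open>\<mu>\<close> become those of a multiplication whose units are the identities
  of the categories \<open>Xx\<close>.
\<close>

abbreviation mult :: "'v \<Rightarrow> 'v \<Rightarrow> 'p \<Rightarrow> 'p \<Rightarrow> 'p \<Rightarrow> 'q \<Rightarrow> 'q \<Rightarrow> 'q" where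
  "mult u u' a c a'' s' s \<equiv> Xmu X u u' (a, a'') (Xclass C X u' u a a'' (c, s', s))"

lemma OMap_Xfun_mem:
  assumes "f \<in> DHor C" "b \<in> Obj (Xcat X (htgt C f))"
  shows "OMap (Xfun X f) b \<in> Obj (Xcat X (hsrc C f))"
  using cat_functor.OMap_Obj[OF Xfun_functor] assms by blast

lemma OMap_Xfun_hid:
  assumes "x \<in> DObj C" "b \<in> Obj (Xcat X x)"
  shows "OMap (Xfun X (hid C x)) b = b"
  using Xfun_hid assms by (simp add: func_eq_def func_id_def)

lemma OMap_Xfun_hcmp:
  assumes "f \<in> DHor C" "g \<in> DHor C" "hsrc C g = htgt C f" "c \<in> Obj (Xcat X (htgt C g))"
  shows "OMap (Xfun X (hcmp C g f)) c = OMap (Xfun X f) (OMap (Xfun X g) c)"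
  using Xfun_hcmp[OF assms(1-3)] assms(4) by (simp add: func_eq_def func_comp_def)

lemma Xsq_mem:
  assumes \<alpha>: "\<alpha> \<in> DSq C"
    and b: "b \<in> Obj (Xcat X (htgt C (sq_top C \<alpha>)))" and b': "b' \<in> Obj (Xcat X (htgt C (sq_bot C \<alpha>)))"
    and t: "t \<in> SOb (Xprof X (sq_right C \<alpha>)) (b, b')"
  shows "Xsq X \<alpha> (b, b') t \<in>
    SOb (Xprof X (sq_left C \<alpha>)) (OMap (Xfun X (sq_top C \<alpha>)) b, OMap (Xfun X (sq_bot C \<alpha>)) b')"
  using nat_trans.component[OF Xsq_trans[OF \<alpha>, unfolded prof_trans_def], of "(b, b')" t] assms
  by (simp add: prod_cat_def op_cat_def sfun_pre_def func_prod_def double_laws)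

lemma SOb_Xprof_vid:
  assumes "x \<in> DObj C" "a \<in> Obj (Xcat X x)" "a' \<in> Obj (Xcat X x)"
  shows "SOb (Xprof X (vid C x)) (a, a') = hom (Xcat X x) a a'"
  using Xprof_vid[OF assms(1)] assms(2,3)
  by (simp add: sfun_eq_def prod_cat_def op_cat_def hom_prof_def)

lemma Idn_hom:
  assumes "x \<in> DObj C" "a \<in> Obj (Xcat X x)"
  shows "Idn (Xcat X x) a \<in> hom (Xcat X x) a a"
proof -
  interpret category "Xcat X x" using assms by (simp add: Xcat_category)
  show ?thesis using assms by (simp add: hom_def category_laws)
qed

lemma Xsq_vid_Idn:
  assumes "f \<in> DHor C" "b \<in> Obj (Xcat X (htgt C f))"
  shows "Xsq X (sq_vid C f) (b, b) (Idn (Xcat X (htgt C f)) b) =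
    Idn (Xcat X (hsrc C f)) (OMap (Xfun X f) b)"
  using Xsq_vid[OF assms(1) assms(2) assms(2) Idn_hom] cat_functor.AMap_Idn[OF Xfun_functor] assms
  by (simp add: double_laws)

lemma mult_mem:
  assumes "u \<in> DVer C" "u' \<in> DVer C" "vsrc C u' = vtgt C u"
    and "a \<in> Obj (Xcat X (vsrc C u))" "c \<in> Obj (Xcat X (vtgt C u))" "a'' \<in> Obj (Xcat X (vtgt C u'))"
    and "s' \<in> SOb (Xprof X u') (c, a'')" "s \<in> SOb (Xprof X u) (a, c)"
  shows "mult u u' a c a'' s' s \<in> SOb (Xprof X (vcmp C u' u)) (a, a'')"
proof -
  have "Xclass C X u' u a a'' (c, s', s) \<in> SOb (Xcomp C X u' u) (a, a'')"
    unfolding Xclass_def Xcomp_def by (rule prof_class_mem) (use assms in simp_all)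
  then show ?thesis
    using nat_trans.component[OF Xmu_trans[OF assms(1-3), unfolded prof_trans_def], of "(a, a'')"] assms
    by (simp add: prod_cat_def op_cat_def)
qed

text \<open>
  Normality identifies \<open>\<mu>[s, 1]\<close> with the action of an identity on \<open>s\<close>.
\<close>

lemma mult_vid_right:
  assumes u: "u \<in> DVer C" and a: "a \<in> Obj (Xcat X (vsrc C u))" and a': "a' \<in> Obj (Xcat X (vtgt C u))"
    and s: "s \<in> SOb (Xprof X u) (a, a')"
  shows "mult (vid C (vsrc C u)) u a a a' s (Idn (Xcat X (vsrc C u)) a) = s"
proof -
  have x: "vsrc C u \<in> DObj C" using u by (simp add: double_laws)
  have e: "Idn (Xcat X (vsrc C u)) a \<in> SOb (Xprof X (vid C (vsrc C u))) (a, a)"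
    using x a by (simp add: SOb_Xprof_vid Idn_hom)
  have "Xclass C X u (vid C (vsrc C u)) a a' (a, s, Idn (Xcat X (vsrc C u)) a) \<in>
      SOb (Xcomp C X u (vid C (vsrc C u))) (a, a')"
    unfolding Xclass_def Xcomp_def
    by (rule prof_class_mem) (use x a s e in \<open>simp_all add: double_laws\<close>)
  then show ?thesis
    using coyoneda_right_class[OF Xprof_profunctor[OF u] Xprof_vid[OF x] a a']
      profunctor_Idn[OF Xprof_profunctor[OF u] a a' s] x
    by (simp add: Xmu_vid_right[OF u a a'] Xclass_def double_laws)
qed

lemma mult_vid_left:
  assumes u: "u \<in> DVer C" and a: "a \<in> Obj (Xcat X (vsrc C u))" and a': "a' \<in> Obj (Xcat X (vtgt C u))"
    and s: "s \<in> SOb (Xprof X u) (a, a')"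
  shows "mult u (vid C (vtgt C u)) a a' a' (Idn (Xcat X (vtgt C u)) a') s = s"
proof -
  have x: "vtgt C u \<in> DObj C" using u by (simp add: double_laws)
  have e: "Idn (Xcat X (vtgt C u)) a' \<in> SOb (Xprof X (vid C (vtgt C u))) (a', a')"
    using x a' by (simp add: SOb_Xprof_vid Idn_hom)
  have "Xclass C X (vid C (vtgt C u)) u a a' (a', Idn (Xcat X (vtgt C u)) a', s) \<in>
      SOb (Xcomp C X (vid C (vtgt C u)) u) (a, a')"
    unfolding Xclass_def Xcomp_def
    by (rule prof_class_mem) (use x a' s e in \<open>simp_all add: double_laws\<close>)
  then show ?thesis
    using coyoneda_left_class[OF Xprof_profunctor[OF u] Xprof_vid[OF x] a a']
      profunctor_Idn[OF Xprof_profunctor[OF u] a a' s] x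
    by (simp add: Xmu_vid_left[OF u a a'] Xclass_def double_laws)
qed

text \<open>
  Both sides are values of the associativity law of \<open>\<mu>\<close> at the class \<open>[[s'', s'], s]\<close>.
\<close>

lemma mult_assoc:
  assumes u: "u \<in> DVer C" and u': "u' \<in> DVer C" and u'': "u'' \<in> DVer C"
    and uu': "vsrc C u' = vtgt C u" and uu'': "vsrc C u'' = vtgt C u'"
    and a: "a \<in> Obj (Xcat X (vsrc C u))" and c: "c \<in> Obj (Xcat X (vtgt C u))"
    and d: "d \<in> Obj (Xcat X (vtgt C u'))" and a''': "a''' \<in> Obj (Xcat X (vtgt C u''))"
    and s: "s \<in> SOb (Xprof X u) (a, c)" and s': "s' \<in> SOb (Xprof X u') (c, d)"
    and s'': "s'' \<in> SOb (Xprof X u'') (d, a''')"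
  shows "mult u (vcmp C u'' u') a c a''' (mult u' u'' c d a''' s'' s') s =
    mult (vcmp C u' u) u'' a d a''' s'' (mult u u' a c d s' s)"
proof -
  let ?A = "Xcat X (vsrc C u)" and ?A' = "Xcat X (vtgt C u)"
  let ?A'' = "Xcat X (vtgt C u')" and ?A''' = "Xcat X (vtgt C u'')"
  note prof = Xprof_profunctor[OF u] Xprof_profunctor[OF u', unfolded uu']
    Xprof_profunctor[OF u'', unfolded uu'']
  have cats: "category ?A" "category ?A'" "category ?A''" "category ?A'''"
    using u u' u'' by (simp_all add: Xcat_category double_laws)
  let ?M = "prof_class ?A ?A' ?A''' (Xcomp C X u'' u') (Xprof X u) a a'''
    (c, Xclass C X u'' u' c a''' (d, s'', s'), s)"
  have L: "Xclass C X u'' u' c a''' (d, s'', s') \<in> SOb (Xcomp C X u'' u') (c, a''')"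
    unfolding Xclass_def Xcomp_def by (rule prof_class_mem) (use d s' s'' in simp_all)
  have M: "?M \<in> SOb (prof_comp ?A ?A' ?A''' (Xcomp C X u'' u') (Xprof X u)) (a, a''')"
    by (rule prof_class_mem) (use c L s in simp_all)
  have outer_left: "prof_sq_comp ?A ?A' ?A''' (Xprof X (vcmp C u'' u')) (Xprof X u)
        func_id func_id func_id (Xmu X u' u'') (\<lambda>_ s. s) (a, a''') ?M =
      Xclass C X (vcmp C u'' u') u a a''' (c, mult u' u'' c d a''' s'' s', s)"
    using prof_sq_comp_class[OF cat_functor_id[OF cats(1)] cat_functor_id[OF cats(2)]
        cat_functor_id[OF cats(4)], unfolded sfun_pre_id, OF prof_trans_id[OF prof(1)]
        Xmu_trans[OF u' u'' uu'', unfolded uu'] a a''']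
    using u' u'' uu'' by (simp add: Xclass_def func_id_def double_laws)
  have assoc: "prof_assoc ?A ?A' ?A'' ?A''' (Xprof X u'') (Xprof X u') (Xprof X u) (a, a''') ?M =
      prof_class ?A ?A'' ?A''' (Xprof X u'') (Xcomp C X u' u) a a'''
        (d, s'', Xclass C X u' u a d (c, s', s))"
    using prof_assoc_class[OF prof a a''' c s] uu' by (simp add: Xclass_def Xcomp_def)
  have outer_right: "prof_sq_comp ?A ?A'' ?A''' (Xprof X u'') (Xprof X (vcmp C u' u))
        func_id func_id func_id (\<lambda>_ s. s) (Xmu X u u') (a, a''')
        (prof_class ?A ?A'' ?A''' (Xprof X u'') (Xcomp C X u' u) a a'''
          (d, s'', Xclass C X u' u a d (c, s', s))) =
      Xclass C X u'' (vcmp C u' u) a a''' (d, s'', mult u u' a c d s' s)"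
    using prof_sq_comp_class[OF cat_functor_id[OF cats(1)] cat_functor_id[OF cats(3)]
        cat_functor_id[OF cats(4)], unfolded sfun_pre_id, OF Xmu_trans[OF u u' uu']
        prof_trans_id[OF prof(3)] a a''']
    using u u' uu' by (simp add: Xclass_def func_id_def double_laws)
  show ?thesis
    using Xmu_assoc[OF u u' u'' uu' uu'' refl refl refl refl a a''' M]
    by (simp only: outer_left assoc outer_right)
qed

text \<open>
  Naturality of \<open>\<mu>\<close> at the class \<open>[t', t]\<close>. This is what makes squares of the Grothendieck construction
  closed under vertical composition.
\<close>

lemma Xsq_mult:
  assumes \<alpha>: "\<alpha> \<in> DSq C" and \<alpha>': "\<alpha>' \<in> DSq C" and top: "sq_top C \<alpha>' = sq_bot C \<alpha>"
    and b: "b \<in> Obj (Xcat X (htgt C (sq_top C \<alpha>)))" and c: "c \<in> Obj (Xcat X (htgt C (sq_bot C \<alpha>)))"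
    and b'': "b'' \<in> Obj (Xcat X (htgt C (sq_bot C \<alpha>')))"
    and t: "t \<in> SOb (Xprof X (sq_right C \<alpha>)) (b, c)"
    and t': "t' \<in> SOb (Xprof X (sq_right C \<alpha>')) (c, b'')"
  shows "Xsq X (sq_vcmp C \<alpha>' \<alpha>) (b, b'') (mult (sq_right C \<alpha>) (sq_right C \<alpha>') b c b'' t' t) =
    mult (sq_left C \<alpha>) (sq_left C \<alpha>') (OMap (Xfun X (sq_top C \<alpha>)) b)
      (OMap (Xfun X (sq_bot C \<alpha>)) c) (OMap (Xfun X (sq_bot C \<alpha>')) b'')
      (Xsq X \<alpha>' (c, b'') t') (Xsq X \<alpha> (b, c) t)"
proof -
  let ?K = "Xclass C X (sq_right C \<alpha>') (sq_right C \<alpha>) b b'' (c, t', t)"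
  have K: "?K \<in> SOb (Xcomp C X (sq_right C \<alpha>') (sq_right C \<alpha>)) (b, b'')"
    unfolding Xclass_def Xcomp_def
    by (rule prof_class_mem) (use \<alpha> c t t' in \<open>simp_all add: double_laws\<close>)
  have hors: "sq_top C \<alpha> \<in> DHor C" "sq_bot C \<alpha> \<in> DHor C" "sq_bot C \<alpha>' \<in> DHor C"
    using \<alpha> \<alpha>' by (simp_all add: double_laws)
  have "prof_sq_comp (Xcat X (vsrc C (sq_left C \<alpha>))) (Xcat X (vtgt C (sq_left C \<alpha>)))
        (Xcat X (vtgt C (sq_left C \<alpha>'))) (Xprof X (sq_left C \<alpha>')) (Xprof X (sq_left C \<alpha>))
        (Xfun X (sq_top C \<alpha>)) (Xfun X (sq_bot C \<alpha>)) (Xfun X (sq_bot C \<alpha>'))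
        (Xsq X \<alpha>') (Xsq X \<alpha>) (b, b'') ?K =
      Xclass C X (sq_left C \<alpha>') (sq_left C \<alpha>) (OMap (Xfun X (sq_top C \<alpha>)) b)
        (OMap (Xfun X (sq_bot C \<alpha>')) b'')
        (OMap (Xfun X (sq_bot C \<alpha>)) c, Xsq X \<alpha>' (c, b'') t', Xsq X \<alpha> (b, c) t)"
    using prof_sq_comp_class[OF Xfun_functor[OF hors(1)] Xfun_functor[OF hors(2)]
        Xfun_functor[OF hors(3)], of "Xprof X (sq_right C \<alpha>)" "Xprof X (sq_left C \<alpha>)" "Xsq X \<alpha>"
        "Xprof X (sq_right C \<alpha>')" "Xprof X (sq_left C \<alpha>')" "Xsq X \<alpha>'" b b'' c t' t]
      Xsq_trans[OF \<alpha>] Xsq_trans[OF \<alpha>'] \<alpha> \<alpha>' top b b''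
    by (simp add: Xclass_def double_laws)
  then show ?thesis
    using Xmu_natural[OF \<alpha> \<alpha>' top refl refl refl refl _ _ K] \<alpha> \<alpha>' b b''
    by (simp add: double_laws)
qed

section \<open>The Grothendieck construction\<close>

text \<open>
  Horizontal morphisms and squares are characterized by their free data: a horizontal morphism is given by \<open>f\<close>
  and its target, a square by \<open>\<alpha>\<close> and its right boundary. That the source and the left boundary lie
  over the right places follows from the typing of \<open>Xf\<close> and \<open>X\<alpha>\<close>.
\<close>

lemma groth_hor_iff:
  "(a, f, b) \<in> groth_hor C X \<longleftrightarrow>
    f \<in> DHor C \<and> b \<in> Obj (Xcat X (htgt C f)) \<and> a = OMap (Xfun X f) b"
  by (auto simp: groth_hor_def OMap_Xfun_mem)

lemma groth_ver_iff:
  "(a, (u, s), a') \<in> groth_ver C X \<longleftrightarrow>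
    u \<in> DVer C \<and> a \<in> Obj (Xcat X (vsrc C u)) \<and> a' \<in> Obj (Xcat X (vtgt C u)) \<and>
    s \<in> SOb (Xprof X u) (a, a')"
  by (simp add: groth_ver_def)

lemma groth_sq_iff:
  "((a, (u, s), a'), \<alpha>, (b, (v, t), b')) \<in> groth_sq C X \<longleftrightarrow>
    \<alpha> \<in> DSq C \<and> v = sq_right C \<alpha> \<and> (b, (v, t), b') \<in> groth_ver C X \<and>
    u = sq_left C \<alpha> \<and> a = OMap (Xfun X (sq_top C \<alpha>)) b \<and> a' = OMap (Xfun X (sq_bot C \<alpha>)) b' \<and>
    s = Xsq X \<alpha> (b, b') t"
  by (auto simp: groth_sq_def groth_ver_iff groth_hor_iff double_laws OMap_Xfun_mem Xsq_mem)

lemma groth_vid_mem: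
  assumes "x \<in> DObj C" "a \<in> Obj (Xcat X x)"
  shows "groth_vid C X (x, a) \<in> groth_ver C X"
  using assms by (simp add: groth_vid_def groth_ver_iff SOb_Xprof_vid Idn_hom double_laws)

lemma groth_vcmp_mem:
  assumes "(a, (u, s), a') \<in> groth_ver C X" "(a', (u', s'), a'') \<in> groth_ver C X"
    and "vsrc C u' = vtgt C u"
  shows "groth_vcmp C X (a', (u', s'), a'') (a, (u, s), a') \<in> groth_ver C X"
  using assms by (simp add: groth_vcmp_def groth_ver_iff mult_mem double_laws)

lemma groth_sq_hid_mem:
  assumes "(a, (u, s), a') \<in> groth_ver C X"
  shows "((a, (u, s), a'), sq_hid C u, (a, (u, s), a')) \<in> groth_sq C X"
  using assms by (simp add: groth_sq_iff groth_ver_iff double_laws OMap_Xfun_hid Xsq_hid)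

text \<open>
  Since \<open>Xe\<^sub>f\<close> is the action of \<open>Xf\<close> on arrows, this holds because \<open>Xf\<close> preserves identities.
\<close>

lemma groth_sq_vid_mem:
  assumes "(a, f, b) \<in> groth_hor C X"
  shows "(groth_vid C X (hsrc C f, a), sq_vid C f, groth_vid C X (htgt C f, b)) \<in> groth_sq C X"
  using assms groth_vid_mem[of "htgt C f" b]
  by (simp add: groth_vid_def groth_sq_iff groth_hor_iff Xsq_vid_Idn double_laws)

lemma groth_sq_hcmp_mem:
  assumes "((a, (u, s), a'), \<alpha>, (b, (v, t), b')) \<in> groth_sq C X"
    and "((b, (v, t), b'), \<beta>, (c, (w, r), c')) \<in> groth_sq C X"
  shows "((a, (u, s), a'), sq_hcmp C \<beta> \<alpha>, (c, (w, r), c')) \<in> groth_sq C X"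
proof -
  have \<alpha>: "\<alpha> \<in> DSq C" and \<beta>: "\<beta> \<in> DSq C" and eq: "sq_left C \<beta> = sq_right C \<alpha>"
    using assms by (simp_all add: groth_sq_iff)
  \<comment> \<open>compare the corners of the common vertical boundary\<close>
  have "hsrc C (sq_top C \<beta>) = htgt C (sq_top C \<alpha>)" "hsrc C (sq_bot C \<beta>) = htgt C (sq_bot C \<alpha>)"
    using vsrc_sq_left[OF \<beta>] vsrc_sq_right[OF \<alpha>] vtgt_sq_left[OF \<beta>] vtgt_sq_right[OF \<alpha>] eq by simp_all
  then show ?thesis
    using assms eq by (auto simp: groth_sq_iff groth_ver_iff double_laws OMap_Xfun_hcmp Xsq_hcmp)
qed

lemma groth_sq_vcmp_mem:
  assumes "((a, (u, s), a'), \<alpha>, (b, (v, t), b')) \<in> groth_sq C X"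
    and "((a', (u', s'), a''), \<alpha>', (b', (v', t'), b'')) \<in> groth_sq C X"
    and "sq_top C \<alpha>' = sq_bot C \<alpha>"
  shows "(groth_vcmp C X (a', (u', s'), a'') (a, (u, s), a'), sq_vcmp C \<alpha>' \<alpha>,
    groth_vcmp C X (b', (v', t'), b'') (b, (v, t), b')) \<in> groth_sq C X"
  using assms groth_vcmp_mem[of b v t b' v' t' b'']
  by (auto simp: groth_vcmp_def groth_sq_iff groth_ver_iff double_laws Xsq_mult)

lemma groth_sel:
  "DObj (groth C X) = groth_obj C X"
  "DHor (groth C X) = groth_hor C X"
  "DVer (groth C X) = groth_ver C X"
  "DSq (groth C X) = groth_sq C X"
  "hsrc (groth C X) (a, f, b) = (hsrc C f, a)"
  "htgt (groth C X) (a, f, b) = (htgt C f, b)"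
  "vsrc (groth C X) (a, (u, s), a') = (vsrc C u, a)"
  "vtgt (groth C X) (a, (u, s), a') = (vtgt C u, a')"
  "sq_left (groth C X) (l, \<alpha>, r) = l"
  "sq_right (groth C X) (l, \<alpha>, r) = r"
  "sq_top (groth C X) ((a, (u, s), a'), \<alpha>, (b, (v, t), b')) = (a, sq_top C \<alpha>, b)"
  "sq_bot (groth C X) ((a, (u, s), a'), \<alpha>, (b, (v, t), b')) = (a', sq_bot C \<alpha>, b')"
  "hid (groth C X) (x, a) = (a, hid C x, a)"
  "hcmp (groth C X) (b, g, c) (a, f, b1) = (a, hcmp C g f, c)"
  "vid (groth C X) = groth_vid C X"
  "vcmp (groth C X) = groth_vcmp C X"
  "sq_hid (groth C X) (a, (u, s), a') = ((a, (u, s), a'), sq_hid C u, (a, (u, s), a'))"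
  "sq_hcmp (groth C X) (m, \<beta>, r) (l, \<alpha>, m') = (l, sq_hcmp C \<beta> \<alpha>, r)"
  "sq_vid (groth C X) (a, f, b) =
    (groth_vid C X (hsrc C f, a), sq_vid C f, groth_vid C X (htgt C f, b))"
  "sq_vcmp (groth C X) (l', \<alpha>', r') (l, \<alpha>, r) =
    (groth_vcmp C X l' l, sq_vcmp C \<alpha>' \<alpha>, groth_vcmp C X r' r)"
  by (simp_all add: groth_def)

lemma category_Hor0_groth: "category (Hor0 (groth C X))"
  by unfold_locales
    (auto simp: Hor0_def groth_sel groth_obj_def groth_hor_iff double_laws OMap_Xfun_mem
      OMap_Xfun_hid OMap_Xfun_hcmp)

lemma category_Hor1_groth: "category (Hor1 (groth C X))"
proof
  show "Cmp (Hor1 (groth C X)) g f \<in> Arr (Hor1 (groth C X))"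
    if "f \<in> Arr (Hor1 (groth C X))" "g \<in> Arr (Hor1 (groth C X))"
      "Src (Hor1 (groth C X)) g = Tgt (Hor1 (groth C X)) f" for f g
    using that by (cases f; cases g) (auto simp: Hor1_def groth_sel intro: groth_sq_hcmp_mem)
qed (auto simp: Hor1_def groth_sel groth_sq_hid_mem, auto simp: groth_sq_def double_laws)

text \<open>
  In the unit laws the object \<open>x\<close> is kept separate from \<open>vsrc C u\<close> and \<open>vtgt C u\<close>: for the boundaries of
  a square it appears as a corner of the top or bottom.
\<close>

lemma groth_vcmp_vid_right:
  assumes "(a, (u, s), a') \<in> groth_ver C X" and "x = vsrc C u"
  shows "groth_vcmp C X (a, (u, s), a') (groth_vid C X (x, a)) = (a, (u, s), a')"
  using assms by (simp add: groth_vcmp_def groth_vid_def groth_ver_iff mult_vid_right double_laws)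

lemma groth_vcmp_vid_left:
  assumes "(a, (u, s), a') \<in> groth_ver C X" and "x = vtgt C u"
  shows "groth_vcmp C X (groth_vid C X (x, a')) (a, (u, s), a') = (a, (u, s), a')"
  using assms by (simp add: groth_vcmp_def groth_vid_def groth_ver_iff mult_vid_left double_laws)

lemma groth_vcmp_assoc:
  assumes "(a, (u, s), a') \<in> groth_ver C X" "(a', (u', s'), a'') \<in> groth_ver C X"
    "(a'', (u'', s''), a''') \<in> groth_ver C X"
    and "vsrc C u' = vtgt C u" "vsrc C u'' = vtgt C u'"
  shows "groth_vcmp C X (a'', (u'', s''), a''') (groth_vcmp C X (a', (u', s'), a'') (a, (u, s), a')) =
    groth_vcmp C X (groth_vcmp C X (a'', (u'', s''), a''') (a', (u', s'), a'')) (a, (u, s), a')"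
  using assms mult_assoc[of u u' u'' a a' a'' a''' s s' s'']
  by (simp add: groth_vcmp_def groth_ver_iff double_laws)

lemma category_Ver0_groth: "category (Ver0 (groth C X))"
proof
  show "Idn (Ver0 (groth C X)) a \<in> Arr (Ver0 (groth C X))" if "a \<in> Obj (Ver0 (groth C X))" for a
    using that by (auto simp: Ver0_def groth_sel groth_obj_def groth_vid_mem)
  show "Cmp (Ver0 (groth C X)) g f \<in> Arr (Ver0 (groth C X))"
    if "f \<in> Arr (Ver0 (groth C X))" "g \<in> Arr (Ver0 (groth C X))"
      "Src (Ver0 (groth C X)) g = Tgt (Ver0 (groth C X)) f" for f g
    using that by (cases f; cases g) (auto simp: Ver0_def groth_sel groth_vcmp_mem)
  show "Cmp (Ver0 (groth C X)) h (Cmp (Ver0 (groth C X)) g f) =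
      Cmp (Ver0 (groth C X)) (Cmp (Ver0 (groth C X)) h g) f"
    if "f \<in> Arr (Ver0 (groth C X))" "g \<in> Arr (Ver0 (groth C X))" "h \<in> Arr (Ver0 (groth C X))"
      "Src (Ver0 (groth C X)) g = Tgt (Ver0 (groth C X)) f"
      "Src (Ver0 (groth C X)) h = Tgt (Ver0 (groth C X)) g" for f g h
    using that by (cases f; cases g; cases h) (auto simp: Ver0_def groth_sel groth_vcmp_assoc)
qed (auto simp: Ver0_def groth_sel groth_vcmp_vid_left groth_vcmp_vid_right,
     auto simp: groth_ver_iff groth_obj_def groth_vid_def groth_vcmp_def groth_sel double_laws)

text \<open>
  The membership in \<open>groth_sq C X\<close> does not reappear among the conclusions, so that the rule can be
  applied exhaustively.
\<close>

lemma groth_sqE: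
  assumes "\<sigma> \<in> groth_sq C X"
  obtains a s a' \<alpha> b t b' where
    "\<sigma> = ((a, (sq_left C \<alpha>, s), a'), \<alpha>, (b, (sq_right C \<alpha>, t), b'))" "\<alpha> \<in> DSq C"
    "(a, (sq_left C \<alpha>, s), a') \<in> groth_ver C X" "(b, (sq_right C \<alpha>, t), b') \<in> groth_ver C X"
    "(a, sq_top C \<alpha>, b) \<in> groth_hor C X" "(a', sq_bot C \<alpha>, b') \<in> groth_hor C X"
  using assms that by (cases \<sigma>) (auto simp: groth_sq_def)

lemma groth_boundaries:
  "vsrc (groth C X) (groth_vid C X (x, a)) = (vsrc C (vid C x), a)"
  "vtgt (groth C X) (groth_vid C X (x, a)) = (vtgt C (vid C x), a)"
  "vsrc (groth C X) (groth_vcmp C X (a', (u', s'), a'') (a, (u, s), a1')) = (vsrc C (vcmp C u' u), a)"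
  "vtgt (groth C X) (groth_vcmp C X (a', (u', s'), a'') (a, (u, s), a1')) = (vtgt C (vcmp C u' u), a'')"
  "sq_top (groth C X) (groth_vid C X (x, a), \<alpha>, groth_vid C X (y, b)) = (a, sq_top C \<alpha>, b)"
  "sq_bot (groth C X) (groth_vid C X (x, a), \<alpha>, groth_vid C X (y, b)) = (a, sq_bot C \<alpha>, b)"
  "sq_top (groth C X) (groth_vcmp C X (a', (u', s'), a'') (a, (u, s), a1'), \<alpha>,
     groth_vcmp C X (b', (v', t'), b'') (b, (v, t), b1')) = (a, sq_top C \<alpha>, b)"
  "sq_bot (groth C X) (groth_vcmp C X (a', (u', s'), a'') (a, (u, s), a1'), \<alpha>,
     groth_vcmp C X (b', (v', t'), b'') (b, (v, t), b1')) = (a'', sq_bot C \<alpha>, b'')"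
  "sq_hid (groth C X) (groth_vid C X (x, a)) =
     (groth_vid C X (x, a), sq_hid C (vid C x), groth_vid C X (x, a))"
  by (simp_all add: groth_vid_def groth_vcmp_def groth_sel)

lemma category_Ver1_groth: "category (Ver1 (groth C X))"
proof
  let ?V = "Ver1 (groth C X)"
  note simps = Ver1_def groth_sel groth_boundaries
  show "Src ?V \<sigma> \<in> Obj ?V" "Tgt ?V \<sigma> \<in> Obj ?V" if "\<sigma> \<in> Arr ?V" for \<sigma>
    using that by (auto simp: simps elim!: groth_sqE)
  show "Idn ?V f \<in> Arr ?V" "Src ?V (Idn ?V f) = f" "Tgt ?V (Idn ?V f) = f" if "f \<in> Obj ?V" for f
    using that by (cases f, auto simp: simps groth_sq_vid_mem groth_hor_iff double_laws)+
  show "Cmp ?V \<tau> \<sigma> \<in> Arr ?V"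
    if "\<sigma> \<in> Arr ?V" "\<tau> \<in> Arr ?V" "Src ?V \<tau> = Tgt ?V \<sigma>" for \<sigma> \<tau>
    using that by (cases \<sigma>; cases \<tau>) (auto simp: simps intro: groth_sq_vcmp_mem)
  show "Src ?V (Cmp ?V \<tau> \<sigma>) = Src ?V \<sigma>"
    and "Tgt ?V (Cmp ?V \<tau> \<sigma>) = Tgt ?V \<tau>"
    if "\<sigma> \<in> Arr ?V" "\<tau> \<in> Arr ?V" "Src ?V \<tau> = Tgt ?V \<sigma>" for \<sigma> \<tau>
    using that by (auto simp: simps double_laws elim!: groth_sqE)
  show "Cmp ?V \<sigma> (Idn ?V (Src ?V \<sigma>)) = \<sigma>" "Cmp ?V (Idn ?V (Tgt ?V \<sigma>)) \<sigma> = \<sigma>"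
    if "\<sigma> \<in> Arr ?V" for \<sigma>
    using that by (auto simp: simps groth_vcmp_vid_left groth_vcmp_vid_right double_laws
        elim!: groth_sqE)
  show "Cmp ?V \<rho> (Cmp ?V \<tau> \<sigma>) = Cmp ?V (Cmp ?V \<rho> \<tau>) \<sigma>"
    if "\<sigma> \<in> Arr ?V" "\<tau> \<in> Arr ?V" "\<rho> \<in> Arr ?V" "Src ?V \<tau> = Tgt ?V \<sigma>" "Src ?V \<rho> = Tgt ?V \<tau>"
    for \<sigma> \<tau> \<rho>
    using that by (auto simp: simps groth_vcmp_assoc double_laws elim!: groth_sqE)
qed

lemma functor_hsrc_groth: "cat_functor (Ver1 (groth C X)) (Ver0 (groth C X)) (hsrc_func (groth C X))"
  by (intro cat_functor.intro category_Ver1_groth category_Ver0_groth, unfold_locales)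
    (auto simp: Ver0_def Ver1_def hsrc_func_def groth_sel groth_obj_def groth_hor_def double_laws
      elim!: groth_sqE)

lemma functor_htgt_groth: "cat_functor (Ver1 (groth C X)) (Ver0 (groth C X)) (htgt_func (groth C X))"
  by (intro cat_functor.intro category_Ver1_groth category_Ver0_groth, unfold_locales)
    (auto simp: Ver0_def Ver1_def htgt_func_def groth_sel groth_obj_def groth_hor_def double_laws
      elim!: groth_sqE)

lemma functor_vsrc_groth: "cat_functor (Hor1 (groth C X)) (Hor0 (groth C X)) (vsrc_func (groth C X))"
  by (intro cat_functor.intro category_Hor1_groth category_Hor0_groth, unfold_locales)
    (auto simp: Hor0_def Hor1_def vsrc_func_def groth_sel groth_obj_def groth_ver_def double_laws
      elim!: groth_sqE)

lemma functor_vtgt_groth: "cat_functor (Hor1 (groth C X)) (Hor0 (groth C X)) (vtgt_func (groth C X))"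
  by (intro cat_functor.intro category_Hor1_groth category_Hor0_groth, unfold_locales)
    (auto simp: Hor0_def Hor1_def vtgt_func_def groth_sel groth_obj_def groth_ver_def double_laws
      elim!: groth_sqE)

lemma functor_hid_groth: "cat_functor (Ver0 (groth C X)) (Ver1 (groth C X)) (hid_func (groth C X))"
  by (intro cat_functor.intro category_Ver1_groth category_Ver0_groth, unfold_locales)
    (auto simp: Ver0_def Ver1_def hid_func_def groth_sel groth_sq_hid_mem groth_obj_def groth_hor_iff
      OMap_Xfun_hid groth_vid_def groth_vcmp_def groth_ver_def double_laws)

lemma functor_vid_groth: "cat_functor (Hor0 (groth C X)) (Hor1 (groth C X)) (vid_func (groth C X))"
  by (intro cat_functor.intro category_Hor1_groth category_Hor0_groth, unfold_locales)
    (auto simp: Hor0_def Hor1_def vid_func_def groth_sel groth_sq_vid_mem groth_obj_def groth_vid_mem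
      groth_hor_iff groth_boundaries OMap_Xfun_mem OMap_Xfun_hid OMap_Xfun_hcmp double_laws)

text \<open>
  A square is determined by its two vertical boundaries and the underlying square of \<open>C\<close>. The two
  sides of the interchange law have the same vertical boundaries by construction, so the law is
  inherited from \<open>C\<close>.
\<close>

theorem double_category_groth: "double_category (groth C X)"
proof (intro double_category.intro category_Hor0_groth category_Hor1_groth category_Ver0_groth
    category_Ver1_groth functor_hsrc_groth functor_htgt_groth functor_hid_groth
    functor_vsrc_groth functor_vtgt_groth functor_vid_groth)
  fix \<alpha> \<beta> \<alpha>' \<beta>'
  assume "\<alpha> \<in> DSq (groth C X)" "\<beta> \<in> DSq (groth C X)" "\<alpha>' \<in> DSq (groth C X)" "\<beta>' \<in> DSq (groth C X)"
    and "sq_left (groth C X) \<beta> = sq_right (groth C X) \<alpha>"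
    and "sq_left (groth C X) \<beta>' = sq_right (groth C X) \<alpha>'"
    and "sq_top (groth C X) \<alpha>' = sq_bot (groth C X) \<alpha>"
    and "sq_top (groth C X) \<beta>' = sq_bot (groth C X) \<beta>"
  then show "sq_vcmp (groth C X) (sq_hcmp (groth C X) \<beta>' \<alpha>') (sq_hcmp (groth C X) \<beta> \<alpha>) =
      sq_hcmp (groth C X) (sq_vcmp (groth C X) \<beta>' \<beta>) (sq_vcmp (groth C X) \<alpha>' \<alpha>)"
    by (auto simp: groth_sel interchange elim!: groth_sqE)
qed

lemma double_functor_groth_proj: "double_functor (groth C X) C groth_proj"
proof (intro double_functor.intro double_functor_axioms.intro double_category_groth
    double_category_axioms)
  show "cat_functor (Hor0 (groth C X)) (Hor0 C) (Hor0_map groth_proj)"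
    by (intro cat_functor.intro category_Hor0_groth category_Hor0, unfold_locales)
      (auto simp: Hor0_def Hor0_map_def groth_proj_def groth_sel groth_obj_def groth_hor_def)
  show "cat_functor (Hor1 (groth C X)) (Hor1 C) (Hor1_map groth_proj)"
    by (intro cat_functor.intro category_Hor1_groth category_Hor1, unfold_locales)
      (auto simp: Hor1_def Hor1_map_def groth_proj_def groth_sel groth_ver_def elim!: groth_sqE)
  show "cat_functor (Ver0 (groth C X)) (Ver0 C) (Ver0_map groth_proj)"
    by (intro cat_functor.intro category_Ver0_groth category_Ver0, unfold_locales)
      (auto simp: Ver0_def Ver0_map_def groth_proj_def groth_sel groth_obj_def groth_ver_def
        groth_vid_def groth_vcmp_def)
  show "cat_functor (Ver1 (groth C X)) (Ver1 C) (Ver1_map groth_proj)"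
    by (intro cat_functor.intro category_Ver1_groth category_Ver1, unfold_locales)
      (auto simp: Ver1_def Ver1_map_def groth_proj_def groth_sel groth_hor_def elim!: groth_sqE)
qed

text \<open>
  The projection at the types of \<open>C\<close> and \<open>X\<close>; its components alone, such as \<open>fsq\<close>, leave the other
  type arguments undetermined.
\<close>

abbreviation (input) proj ::
  "('o \<times> 'p, ('h, 'p) ghor, ('v, 'p, 'q) gver, ('v, 's, 'p, 'q) gsq, 'o, 'h, 'v, 's) dfunc" where
  "proj \<equiv> groth_proj"

lemma groth_hor_unique_lift:
  assumes y: "y \<in> groth_obj C X" and f: "f \<in> DHor C" and eq: "fobj proj y = htgt C f"
  shows "\<exists>!h. h \<in> groth_hor C X \<and> htgt (groth C X) h = y \<and> fhor proj h = f"
proof -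
  obtain b where y_eq: "y = (htgt C f, b)"
    using eq by (cases y) (simp add: groth_proj_def)
  show ?thesis
  proof (rule ex1I)
    show "(OMap (Xfun X f) b, f, b) \<in> groth_hor C X \<and>
        htgt (groth C X) (OMap (Xfun X f) b, f, b) = y \<and>
        fhor proj (OMap (Xfun X f) b, f, b) = f"
      using y f by (simp add: groth_hor_iff groth_obj_def groth_sel groth_proj_def y_eq)
  next
    fix h
    assume "h \<in> groth_hor C X \<and> htgt (groth C X) h = y \<and> fhor proj h = f"
    then show "h = (OMap (Xfun X f) b, f, b)"
      by (cases h) (simp add: groth_hor_iff groth_sel groth_proj_def y_eq)
  qed
qed

lemma groth_sq_unique_lift:
  assumes r: "r \<in> groth_ver C X" and \<alpha>: "\<alpha> \<in> DSq C" and eq: "fver proj r = sq_right C \<alpha>"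
  shows "\<exists>!\<sigma>. \<sigma> \<in> groth_sq C X \<and> sq_right (groth C X) \<sigma> = r \<and> fsq proj \<sigma> = \<alpha>"
proof -
  obtain b t b' where r_eq: "r = (b, (sq_right C \<alpha>, t), b')"
    using eq by (cases r) (auto simp: groth_proj_def)
  let ?\<sigma> = "((OMap (Xfun X (sq_top C \<alpha>)) b, (sq_left C \<alpha>, Xsq X \<alpha> (b, b') t),
    OMap (Xfun X (sq_bot C \<alpha>)) b'), \<alpha>, r)"
  show ?thesis
  proof (rule ex1I)
    show "?\<sigma> \<in> groth_sq C X \<and> sq_right (groth C X) ?\<sigma> = r \<and> fsq proj ?\<sigma> = \<alpha>"
      using r \<alpha> by (simp add: groth_sq_iff groth_sel groth_proj_def r_eq)
  next
    fix \<sigma>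
    assume "\<sigma> \<in> groth_sq C X \<and> sq_right (groth C X) \<sigma> = r \<and> fsq proj \<sigma> = \<alpha>"
    then show "\<sigma> = ?\<sigma>"
      by (cases \<sigma>) (auto simp: groth_sq_iff groth_sel groth_proj_def r_eq)
  qed
qed

lemma is_pullback_groth_proj:
  "is_pullback TYPE('qo \<times> 'qa) (Ver1 (groth C X)) (Ver0 (groth C X)) (Ver1 C) (Ver0 C)
    (htgt_func (groth C X)) (Ver1_map proj) (Ver0_map proj) (htgt_func C)"
proof (rule is_pullbackI[OF functor_htgt_groth _ _ functor_htgt])
  note sel = Ver0_def Ver1_def Ver0_map_def Ver1_map_def htgt_func_def groth_sel cat.simps func.simps
  show "cat_functor (Ver1 (groth C X)) (Ver1 C) (Ver1_map proj)"
    by (rule double_functor.functor_Ver1[OF double_functor_groth_proj])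
  show "cat_functor (Ver0 (groth C X)) (Ver0 C) (Ver0_map proj)"
    by (rule double_functor.functor_Ver0[OF double_functor_groth_proj])
  have "fobj proj (htgt (groth C X) h) = htgt C (fhor proj h)" for h
    by (cases h) (simp add: groth_sel groth_proj_def)
  moreover have "fver proj (sq_right (groth C X) \<sigma>) = sq_right C (fsq proj \<sigma>)"
    if "\<sigma> \<in> groth_sq C X" for \<sigma>
    using that by (auto simp: groth_sel groth_proj_def elim!: groth_sqE)
  ultimately show "func_eq (Ver1 (groth C X)) (func_comp (Ver0_map proj) (htgt_func (groth C X)))
      (func_comp (htgt_func C) (Ver1_map proj))"
    by (simp add: func_eq_def func_comp_def sel)
  show "\<exists>!h. h \<in> Obj (Ver1 (groth C X)) \<and> OMap (htgt_func (groth C X)) h = y \<and>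
      OMap (Ver1_map proj) h = f"
    if "y \<in> Obj (Ver0 (groth C X))" "f \<in> Obj (Ver1 C)"
      "OMap (Ver0_map proj) y = OMap (htgt_func C) f" for y f
    using that unfolding sel by (rule groth_hor_unique_lift)
  show "\<exists>!\<sigma>. \<sigma> \<in> Arr (Ver1 (groth C X)) \<and> AMap (htgt_func (groth C X)) \<sigma> = r \<and>
      AMap (Ver1_map proj) \<sigma> = \<alpha>"
    if "r \<in> Arr (Ver0 (groth C X))" "\<alpha> \<in> Arr (Ver1 C)"
      "AMap (Ver0_map proj) r = AMap (htgt_func C) \<alpha>" for r \<alpha>
    using that unfolding sel by (rule groth_sq_unique_lift)
qed

end

theorem proposition6p1p4:
  fixes C :: "('o, 'h, 'v, 's) dcat"
    and X :: "('o, 'h, 'v, 's, 'p, 'q) dpsh"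
  assumes "double_category C"
    and "lax_double_presheaf C X"
  shows "discrete_double_fibration TYPE('qo \<times> 'qa) (groth C X) C groth_proj"
proof -
  interpret lax_double_presheaf C X by (rule assms(2))
  show ?thesis
    unfolding discrete_double_fibration_def
    using double_functor_groth_proj is_pullback_groth_proj by (rule conjI)
qed

end
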